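(* Let $E,A\in\mathbb{C}^{n\times n}$ and $b\in\mathbb{C}^n$ (the data of the single input differential-algebraic system $\frac{d}{dt}Ex(t)=Ax(t)+bu(t)$, $t\in[0,\infty)$, $x(0)=x_0$) be such that $\mathcal{A}(s)=sE-A$ is a regular matrix pencil. Choose pairwise distinct numbers $\mu_1,\ldots,\mu_l\in\overline{\mathbb{C}}$ with $l\leq M(\mathcal{A},0,-b)$ and multiplicities $m_1,\ldots,m_l\in\mathbb{N}\setminus\{0\}$ with $\sum_{i=1}^lm_i=M(\mathcal{A},0,-b)$. Then: (a) For $E$ singular there exists a feedback vector $f\in\mathbb{C}^n$ such that $sE-(A+bf^* )$ is regular and $\sigma(sE-(A+bf^* ))$ equals $$\{\mu_1,\ldots,\mu_l\}\cup\{\lambda\in\sigma(\mathcal{A}) : \dim\ker\mathcal{A}(\lambda)\geq 2\ \text{or}\ m_{0,-b}(\lambda)< m_1(\lambda)\}.\qquad(\ast)$$ (b) For $E$ invertible and $\infty\notin\{\mu_1,\ldots,\mu_l\}$ there exists a feedback vector $f\in\mathbb{C}^n$ such that $sE-(A+bf^* )$ is regular and $\sigma(sE-(A+bf^* ))$ equals $(\ast)$. In both cases (a) and (b), with $\mathcal{P}(s)=-bf^*$, the dimensions of the root subspaces are given by $$\dim \mathcal{L}_{\lambda}(\mathcal{A}+\mathcal{P})=\begin{cases}\dim \mathcal{L}_{\lambda}(\mathcal{A})-m_{0,-b}(\lambda)+m_i, & \text{for }\lambda=\mu_i\in\sigma(\mathcal{A}), \\ \dim \mathcal{L}_{\lambda}(\mathcal{A})-m_{0,-b}(\lambda),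 & \text{for }\lambda\in\sigma(\mathcal{A})\setminus\{\mu_1,\ldots,\mu_l\}, \\ m_i, & \text{for }\lambda=\mu_i\notin\sigma(\mathcal{A}), \\ 0, & \text{for }\lambda\notin\sigma(\mathcal{A})\cup\{\mu_1,\ldots,\mu_l\}.\end{cases}$$ If $E,A$ are real matrices and $b\in\mathbb{R}^n$, then $f$ can be chosen in $\mathbb{R}^n$.
   Context: $\overline{\mathbb{C}}:=\mathbb{C}\cup\{\infty\}$. A matrix pencil is $\mathcal{A}(s)=sE-A$ with $E,A\in\mathbb{C}^{n\times n}$; sums of pencils are formed pointwise. It is regular if $\det(sE-A)$ is not the zero polynomial. For $\lambda\in\mathbb{C}$, $\mathcal{A}(\lambda)=\lambda E-A$, and $\mathcal{A}(\infty):=E$ (the leading coefficient). The spectrum $\sigma(\mathcal{A})\subseteq\overline{\mathbb{C}}$ is the set of $\lambda\in\overline{\mathbb{C}}$ such that $\mathcal{A}(\lambda)$ is singular. The state feedback $u(t)=f^*x(t)$ leads to the closed-loop pencil $sE-(A+bf^* )$. Jordan chains: $\{g_0,\ldots,g_{m-1}\}\subset\mathbb{C}^n$ is a Jordan chain of length $m$ at $\lambda\in\mathbb{C}$ if $g_0\neq0$, $(A-\lambda E)g_0=0$ and $(A-\lambda E)g_j=Eg_{j-1}$ for $1\le j\le m-1$; it is a Jordan chain of length $m$ at $\infty$ if $g_0\neq0$, $Eg_0=0$ and $Eg_j=Ag_{j-1}$ for $1\le j\le m-1$. The root subspace $\mathcal{L}_\lambda(\mathcal{A})$, $\lambda\in\overline{\mathbb{C}}$,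 is the subspace consisting of the zero vector and all elements of all Jordan chains of $\mathcal{A}(s)$ at $\lambda$. For $\lambda\in\sigma(\mathcal{A})$, $m_1(\lambda)$ (not to be confused with the chosen multiplicities $m_i$) is the length of the longest Jordan chain of $\mathcal{A}(s)$ at $\lambda$. For $\lambda\in\sigma(\mathcal{A})\setminus\{\infty\}$, $m_{0,-b}(\lambda)$ is the order of $\lambda$ as a pole of the vector-valued rational function $s\mapsto(sE-A)^{-1}(-b)$, i.e. the maximal order of $\lambda$ as a pole of one of its entries, and $m_{0,-b}(\lambda)=0$ if no entry has a pole at $\lambda$. If $\infty\in\sigma(\mathcal{A})$, $m_{0,-b}(\infty)$ is the order of the pole at $s=0$ of $s\mapsto(-sA+E)^{-1}(-sb)$ (again $0$ if there is no pole). Finally $M(\mathcal{A},0,-b):=\sum_{\mu\in\sigma(\mathcal{A})}m_{0,-b}(\mu)$.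
   Formalization: In (a), if ∞ is one of the μ_i, it is also assumed that (E−sA)^{-1}b has a pole at s=0; for real f, the μ_i with their multiplicities m_i are assumed symmetric under complex conjugation. The claim fails without these conditions. *)

theory Defs
  imports "HOL-Complex_Analysis.Complex_Analysis"
begin

text \<open>
  A matrix pencil s E - A is given by the pair of its coefficients E and A.
  The perturbation P(s) = - b f* does not depend on s, so the sum of both pencils is
  s E - (A + b f*), with the coefficients E and A + b f*.
\<close>

datatype ext_complex = Fin complex | Infty

definition regular_pencil :: "complex^'n^'n \<Rightarrow> complex^'n^'n \<Rightarrow> bool" where
  "regular_pencil E A \<longleftrightarrow> det (\<chi> i j. [:- (A $ i $ j), E $ i $ j:]) \<noteq> (0 :: complex poly)"

fun pencil_at :: "complex^'n^'n \<Rightarrow> complex^'n^'n \<Rightarrow> ext_complex \<Rightarrow> complex^'n^'n" where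
  "pencil_at E A (Fin z) = (\<chi> i j. z * E $ i $ j - A $ i $ j)"
| "pencil_at E A Infty = E"

definition rev_pencil_at :: "complex^'n^'n \<Rightarrow> complex^'n^'n \<Rightarrow> complex \<Rightarrow> complex^'n^'n" where
  "rev_pencil_at E A z = (\<chi> i j. - z * A $ i $ j + E $ i $ j)"

definition pencil_spectrum :: "complex^'n^'n \<Rightarrow> complex^'n^'n \<Rightarrow> ext_complex set" where
  "pencil_spectrum E A = {x. \<not> invertible (pencil_at E A x)}"

text \<open>Dimensions are complex ones: \<open>vec.dim\<close>, whereas \<open>dim\<close> would be the dimension over the reals.\<close>

definition ker_dim :: "complex^'n^'n \<Rightarrow> nat" where
  "ker_dim B = vec.dim {v. B *v v = 0}"

text \<open>The list \<open>gs\<close> is the chain g_0, ..., g_(m-1), with m the length of \<open>gs\<close>.\<close>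

fun jordan_chain ::
    "complex^'n^'n \<Rightarrow> complex^'n^'n \<Rightarrow> ext_complex \<Rightarrow> (complex^'n) list \<Rightarrow> bool" where
  "jordan_chain E A (Fin z) gs \<longleftrightarrow>
     gs \<noteq> [] \<and> gs ! 0 \<noteq> 0 \<and> (\<chi> i j. A $ i $ j - z * E $ i $ j) *v (gs ! 0) = 0 \<and>
     (\<forall>k. 1 \<le> k \<and> k < length gs \<longrightarrow>
        (\<chi> i j. A $ i $ j - z * E $ i $ j) *v (gs ! k) = E *v (gs ! (k - 1)))"
| "jordan_chain E A Infty gs \<longleftrightarrow>
     gs \<noteq> [] \<and> gs ! 0 \<noteq> 0 \<and> E *v (gs ! 0) = 0 \<and>
     (\<forall>k. 1 \<le> k \<and> k < length gs \<longrightarrow> E *v (gs ! k) = A *v (gs ! (k - 1)))"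

definition root_subspace ::
    "complex^'n^'n \<Rightarrow> complex^'n^'n \<Rightarrow> ext_complex \<Rightarrow> (complex^'n) set" where
  "root_subspace E A x = {0} \<union> \<Union> {set gs | gs. jordan_chain E A x gs}"

text \<open>
  For a regular pencil the lengths of the Jordan chains are bounded by n, and there is a chain
  at every point of the spectrum, so that the maximum below is a genuine one there.
\<close>

definition max_chain_length :: "complex^'n^'n \<Rightarrow> complex^'n^'n \<Rightarrow> ext_complex \<Rightarrow> nat" where
  "max_chain_length E A x = Max {length gs | gs. jordan_chain E A x gs}"

definition pole_order :: "(complex \<Rightarrow> complex) \<Rightarrow> complex \<Rightarrow> nat" where
  "pole_order h z = (if is_pole h z then nat (- zorder h z) else 0)"

definition vec_pole_order :: "(complex \<Rightarrow> complex^'n) \<Rightarrow> complex \<Rightarrow> nat" where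
  "vec_pole_order h z = Max (range (\<lambda>i. pole_order (\<lambda>s. h s $ i) z))"

text \<open>
  \<open>m0 E A u\<close> is m_{0,u}, to be used with u = -b. The value of \<open>matrix_inv\<close> at the finitely many
  points where the pencil is singular is irrelevant, as poles only depend on a punctured
  neighbourhood.
\<close>

fun m0 :: "complex^'n^'n \<Rightarrow> complex^'n^'n \<Rightarrow> complex^'n \<Rightarrow> ext_complex \<Rightarrow> nat" where
  "m0 E A u (Fin z) = vec_pole_order (\<lambda>s. matrix_inv (pencil_at E A (Fin s)) *v u) z"
| "m0 E A u Infty = vec_pole_order (\<lambda>s. matrix_inv (rev_pencil_at E A s) *v (s *s u)) 0"

definition M0 :: "complex^'n^'n \<Rightarrow> complex^'n^'n \<Rightarrow> complex^'n \<Rightarrow> nat" where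
  "M0 E A u = (\<Sum>x\<in>pencil_spectrum E A. m0 E A u x)"

text \<open>The rank one matrix b f*.\<close>

definition outer :: "complex^'n \<Rightarrow> complex^'n \<Rightarrow> complex^'n^'n" where
  "outer b f = (\<chi> i j. b $ i * cnj (f $ j))"

definition real_vec :: "complex^'n \<Rightarrow> bool" where
  "real_vec v \<longleftrightarrow> (\<forall>i. v $ i \<in> \<real>)"

definition real_mat :: "complex^'n^'n \<Rightarrow> bool" where
  "real_mat B \<longleftrightarrow> (\<forall>i j. B $ i $ j \<in> \<real>)"

text \<open>
  The vector function inv(E - s A) b has a pole at s = 0, i.e. b has a nonzero component in the part of the
  Weierstrass form belonging to the eigenvalue infinity. Otherwise
  det (s E - (A + b f*)) has the same degree as det (s E - A) for every f, so that no feedback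
  changes the multiplicity of infinity, whereas \<open>m0 E A (- b) Infty = 0\<close> does not exclude this.
\<close>

definition acts_at_infinity :: "complex^'n^'n \<Rightarrow> complex^'n^'n \<Rightarrow> complex^'n \<Rightarrow> bool" where
  "acts_at_infinity E A b \<longleftrightarrow> 0 < vec_pole_order (\<lambda>s. matrix_inv (rev_pencil_at E A s) *v b) 0"

text \<open>
  The eigenvalues to be placed are \<open>\<mu> 1, \<dots>, \<mu> l\<close> with multiplicities \<open>m 1, \<dots>, m l\<close>.
  A real pencil has a spectrum which is symmetric with respect to the real line, including
  multiplicities, so this is required of the prescribed data when a real feedback is sought.
\<close>

definition conj_symmetric :: "nat \<Rightarrow> (nat \<Rightarrow> ext_complex) \<Rightarrow> (nat \<Rightarrow> nat) \<Rightarrow> bool" where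
  "conj_symmetric l \<mu> m \<longleftrightarrow>
     (\<forall>i\<in>{1..l}. \<forall>z. \<mu> i = Fin z \<longrightarrow> (\<exists>j\<in>{1..l}. \<mu> j = Fin (cnj z) \<and> m j = m i))"

definition target_spectrum ::
    "complex^'n^'n \<Rightarrow> complex^'n^'n \<Rightarrow> complex^'n \<Rightarrow> nat \<Rightarrow> (nat \<Rightarrow> ext_complex) \<Rightarrow> ext_complex set" where
  "target_spectrum E A b l \<mu> = \<mu> ` {1..l} \<union>
     {x \<in> pencil_spectrum E A.
        ker_dim (pencil_at E A x) \<ge> 2 \<or> m0 E A (- b) x < max_chain_length E A x}"

definition target_root_dims ::
    "complex^'n^'n \<Rightarrow> complex^'n^'n \<Rightarrow> complex^'n \<Rightarrow> nat \<Rightarrow> (nat \<Rightarrow> ext_complex) \<Rightarrow> (nat \<Rightarrow> nat)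
       \<Rightarrow> complex^'n \<Rightarrow> bool" where
  "target_root_dims E A b l \<mu> m f \<longleftrightarrow>
     (let dimA = (\<lambda>x. int (vec.dim (root_subspace E A x)));
          dimAP = (\<lambda>x. int (vec.dim (root_subspace E (A + outer b f) x)));
          S = pencil_spectrum E A
      in (\<forall>i\<in>{1..l}. \<mu> i \<in> S \<longrightarrow> dimAP (\<mu> i) = dimA (\<mu> i) - int (m0 E A (- b) (\<mu> i)) + int (m i)) \<and>
         (\<forall>x \<in> S - \<mu> ` {1..l}. dimAP x = dimA x - int (m0 E A (- b) x)) \<and>
         (\<forall>i\<in>{1..l}. \<mu> i \<notin> S \<longrightarrow> dimAP (\<mu> i) = int (m i)) \<and>
         (\<forall>x. x \<notin> S \<union> \<mu> ` {1..l} \<longrightarrow> dimAP x = 0))"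

definition places ::
    "complex^'n^'n \<Rightarrow> complex^'n^'n \<Rightarrow> complex^'n \<Rightarrow> nat \<Rightarrow> (nat \<Rightarrow> ext_complex) \<Rightarrow> (nat \<Rightarrow> nat)
       \<Rightarrow> complex^'n \<Rightarrow> bool" where
  "places E A b l \<mu> m f \<longleftrightarrow>
     regular_pencil E (A + outer b f) \<and>
     pencil_spectrum E (A + outer b f) = target_spectrum E A b l \<mu> \<and>
     target_root_dims E A b l \<mu> m f"

end

theory Submission imports Defs "HOL-Computational_Algebra.Fundamental_Theorem_Algebra" begin

text \<open>
  Write \<open>(s E - A)\<^sup>-\<^sup>1 b = p / q\<close> in lowest terms, with \<open>q\<close> monic, and \<open>det (s E - A) = h q\<close>. Cramer's
  rule and the rank one determinant formula give \<open>det (s E - (A + b f*)) = h (q - f* p)\<close>. By a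
  Fitting decomposition, the dimension of the root subspace at a finite point is the order of the
  determinant there, and at infinity it is \<open>n\<close> minus the degree. Since \<open>m0\<close> is the order of \<open>q\<close>
  at a finite point, and \<open>deg p - deg q\<close> (or 0) at infinity, the claim on the dimensions says that
  \<open>q - f* p\<close> is the monic polynomial with the prescribed finite roots. Such an \<open>f\<close> exists as the
  components of \<open>p\<close> span all polynomials of degree at most \<open>deg p\<close>: by the resolvent identity
  their span is closed under division by linear factors \<open>s - t\<close> with \<open>t\<close> outside the spectrum, so
  one element of maximal degree without roots in the spectrum yields elements of all lower degrees.
  For real data \<open>p\<close>, \<open>q\<close> and the target polynomial are real, and \<open>f\<close> may be replaced by its real part.
\<close>

section \<open>Nilpotent part of a matrix\<close>

text \<open>The obstacle is that neither \<open>E\<close> nor \<open>A\<close> need be invertible,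
  so no single matrix is at hand that carries the Jordan chains. At each point, finite or infinite,
  the pencil is written as \<open>u Y - X\<close> in a local parameter \<open>u\<close>, and
  regularity yields \<open>c\<close> with \<open>Z = Y + c X\<close> invertible. With
  \<open>T = Z^-1 X\<close> one gets \<open>u Y - X = Z (u - (1 + c u) T)\<close>; the chains are
  those of the nilpotent part of \<open>T\<close> up to the unipotent factor \<open>1 - c T\<close>.

  The degrees of \<open>p\<close> and \<open>q\<close> decide what can be placed at infinity. For
  nonzero \<open>b\<close>, \<open>deg q\<close> exceeds \<open>deg p\<close> by at most one. If it
  does, \<open>q - f* p\<close> keeps the leading term of \<open>q\<close> and the multiplicity of
  infinity is fixed; a monic target of the same degree then differs from \<open>q\<close> by a
  polynomial within reach. Otherwise every target of degree at most \<open>deg p\<close> is within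
  reach, and \<open>acts_at_infinity\<close> forces this case when infinity is prescribed.

  The second set in the spectrum claim amounts to \<open>m0\<close> being smaller than the dimension
  of the root subspace; the spectrum is then read off from the dimensions.\<close>

lemma dim_image_plus_kernel:
  fixes f :: "'a::field^'m \<Rightarrow> 'a^'n"
  assumes f: "Vector_Spaces.linear (*s) (*s) f" and V: "vec.subspace V"
  shows "vec.dim (f ` V) + vec.dim {v \<in> V. f v = 0} = vec.dim V"
proof -
  interpret f: Vector_Spaces.linear "(*s)" "(*s)" f by fact
  let ?K = "{v \<in> V. f v = 0}"
  obtain B1 where B1: "B1 \<subseteq> ?K" "vec.independent B1" "?K \<subseteq> vec.span B1" "card B1 = vec.dim ?K"
    using vec.basis_exists by blast
  have "B1 \<subseteq> V" using B1 by auto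
  then obtain B where B: "B1 \<subseteq> B" "B \<subseteq> V" "vec.independent B" "V \<subseteq> vec.span B"
    using vec.maximal_independent_subset_extend B1(2) by blast
  have spB: "vec.span B = V" using B V by (simp add: vec.span_subspace)
  have finB: "finite B" using B(3) vec.finiteI_independent by blast
  let ?C = "B - B1"
  have cardC: "card ?C + card B1 = card B"
    using card_Diff_subset[OF finite_subset[OF B(1) finB] B(1)] card_mono[OF finB B(1)] by linarith
  have spK: "vec.span B1 \<subseteq> ?K"
    by (rule vec.span_minimal[OF B1(1)]) (use V in \<open>auto simp: vec.subspace_def f.add f.scale\<close>)
  have int0: "v = 0" if v: "v \<in> vec.span ?C" "f v = 0" for v
  proof -
    have "v \<in> V" using vec.span_mono[OF Diff_subset, of B B1] v(1) unfolding spB by blast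
    then have "v \<in> vec.span B1" using v B1(3) by auto
    then have "v \<in> vec.span B1 \<inter> vec.span ?C" using v by auto
    moreover have "vec.span B1 \<inter> vec.span ?C \<subseteq> {0}"
    proof -
      have "{x + y |x y. x \<in> vec.span B1 \<and> y \<in> vec.span ?C} = vec.span B"
        using vec.span_Un[of B1 ?C] B(1) by (simp add: Un_absorb1)
      moreover have "vec.independent ?C" by (rule vec.independent_mono[OF B(3) Diff_subset])
      ultimately have "card B + vec.dim (vec.span B1 \<inter> vec.span ?C) = card B1 + card ?C"
        using vec.dim_sums_Int[OF vec.subspace_span vec.subspace_span, of B1 ?C]
        by (simp add: vec.dim_eq_card_independent B(3) B1(2))
      then have "vec.dim (vec.span B1 \<inter> vec.span ?C) = 0" using cardC by linarith
      then show ?thesis by (simp only: vec.dim_eq_0)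
    qed
    ultimately show ?thesis by auto
  qed
  have inj: "inj_on f (vec.span ?C)"
  proof (rule inj_onI)
    fix x y assume "x \<in> vec.span ?C" "y \<in> vec.span ?C" "f x = f y"
    then have "x - y = 0" by (intro int0) (auto simp: vec.span_diff f.diff)
    then show "x = y" by simp
  qed
  have d1: "vec.dim (f ` ?C) = vec.dim ?C" by (rule vec.dim_image_eq[OF f inj])
  have d2: "vec.dim ?C = card ?C"
    by (rule vec.dim_eq_card_independent[OF vec.independent_mono[OF B(3) Diff_subset]])
  have d3: "vec.dim (f ` V) = vec.dim (f ` ?C)"
  proof -
    have "f ` V = vec.span (f ` B)" using f.span_image[of B] by (simp only: spB)
    also have "\<dots> = vec.span (f ` ?C)"
    proof (rule antisym)
      show "vec.span (f ` ?C) \<subseteq> vec.span (f ` B)" by (rule vec.span_mono) auto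
      show "vec.span (f ` B) \<subseteq> vec.span (f ` ?C)"
      proof (rule vec.span_minimal)
        show "f ` B \<subseteq> vec.span (f ` ?C)"
        proof safe
          fix x assume "x \<in> B"
          show "f x \<in> vec.span (f ` ?C)"
          proof (cases "x \<in> B1")
            case True
            then have "f x = 0" using B1 by auto
            then show ?thesis by (simp add: vec.span_zero)
          next
            case False
            with \<open>x \<in> B\<close> show ?thesis by (intro vec.span_base) auto
          qed
        qed
      qed (rule vec.subspace_span)
    qed
    finally show ?thesis by simp
  qed
  have d4: "vec.dim V = card B" using vec.dim_span_eq_card_independent[OF B(3)] by (simp only: spB)
  show ?thesis unfolding d3 d1 d2 d4 B1(4)[symmetric] by (rule cardC)
qed

lemma mat_mult_vec: "mat u *v x = u *s (x :: 'a::comm_ring_1^'n)"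
  by (simp add: vec_eq_iff matrix_vector_mult_def mat_def if_distrib [of "\<lambda>x. x * _"] cong: if_cong)

lemma invertible_iff_kernel:
  "invertible (A :: 'a::field^'n^'n) \<longleftrightarrow> (\<forall>x. A *v x = 0 \<longrightarrow> x = 0)"
  by (simp add: invertible_left_inverse matrix_left_invertible_ker)

lemma linear_funpow:
  "Vector_Spaces.linear (*s) (*s) (((*v) (T :: 'a::field^'n^'n)) ^^ k)"
proof (induction k)
  case 0
  show ?case using vec.linear_id by (simp add: id_def)
next
  case (Suc k)
  then show ?case unfolding funpow.simps
    by (intro Vector_Spaces.linear_compose[OF Suc.IH matrix_vector_mul_linear_gen])
qed

text \<open>The generalized kernel (Fitting null component) of \<open>T\<close>; it turns out to be
  the root subspace of the pencil behind \<open>T\<close>.\<close>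

definition nil_space :: "'a::field^'n^'n \<Rightarrow> ('a^'n) set" where
  "nil_space T = {v. \<exists>k. ((*v) T ^^ k) v = 0}"

lemma funpow_mult_0 [simp]: "((*v) (T :: 'a::field^'n^'n) ^^ k) 0 = 0"
  by (induction k) auto

lemma funpow_zero_mono:
  assumes "((*v) (T :: 'a::field^'n^'n) ^^ k) v = 0" "k \<le> j"
  shows "((*v) T ^^ j) v = 0"
proof -
  have "((*v) T ^^ j) v = ((*v) T ^^ (j - k)) (((*v) T ^^ k) v)"
    using assms(2) by (simp add: funpow_add[symmetric, THEN fun_cong, unfolded comp_apply])
  then show ?thesis using assms(1) by simp
qed

lemma subspace_nil_space: "vec.subspace (nil_space T)"
proof (unfold vec.subspace_def, intro conjI ballI allI)
  show "0 \<in> nil_space T" by (simp add: nil_space_def)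
next
  fix x y assume "x \<in> nil_space T" "y \<in> nil_space T"
  then obtain j k where "((*v) T ^^ j) x = 0" "((*v) T ^^ k) y = 0" by (auto simp: nil_space_def)
  then have "((*v) T ^^ (j + k)) x = 0" "((*v) T ^^ (j + k)) y = 0"
    by (simp_all add: funpow_zero_mono[OF _ le_add1] funpow_zero_mono[OF _ le_add2])
  then have "((*v) T ^^ (j + k)) (x + y) = 0"
    using module_hom.add[OF linear_funpow[of "j + k" T, unfolded Vector_Spaces.linear_iff_module_hom]] by simp
  then show "x + y \<in> nil_space T" by (auto simp: nil_space_def)
next
  fix c x assume "x \<in> nil_space T"
  then obtain j where "((*v) T ^^ j) x = 0" by (auto simp: nil_space_def)
  then have "((*v) T ^^ j) (c *s x) = 0"
    using module_hom.scale[OF linear_funpow[of j T, unfolded Vector_Spaces.linear_iff_module_hom]] by simp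
  then show "c *s x \<in> nil_space T" by (auto simp: nil_space_def)
qed

lemma nil_space_eq_kernel: "\<exists>N. \<forall>k\<ge>N. nil_space T = {v. ((*v) T ^^ k) v = 0}"
proof -
  obtain B where B: "B \<subseteq> nil_space T" "vec.independent B" "nil_space T \<subseteq> vec.span B" "card B = vec.dim (nil_space T)"
    by (rule vec.basis_exists)
  have "\<forall>b\<in>B. \<exists>k. ((*v) T ^^ k) b = 0" using B by (auto simp: nil_space_def)
  then obtain e where e: "\<And>b. b \<in> B \<Longrightarrow> ((*v) T ^^ e b) b = 0" by metis
  have "finite B" using B(2) vec.finiteI_independent by blast
  then obtain N where N: "\<And>b. b \<in> B \<Longrightarrow> e b \<le> N"
    using that[of "Max (e ` B)"] by simp
  have *: "nil_space T \<subseteq> {v. ((*v) T ^^ k) v = 0}" if "k \<ge> N" for k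
  proof -
    interpret Tk: Vector_Spaces.linear "(*s)" "(*s)" "(*v) T ^^ k" by (rule linear_funpow)
    have "vec.span B \<subseteq> {v. ((*v) T ^^ k) v = 0}"
    proof (rule vec.span_minimal)
      show "B \<subseteq> {v. ((*v) T ^^ k) v = 0}"
        using funpow_zero_mono[OF e le_trans[OF N that]] by blast
    qed (auto simp: vec.subspace_def Tk.add Tk.scale)
    then show ?thesis using B by blast
  qed
  have "{v. ((*v) T ^^ k) v = 0} \<subseteq> nil_space T" for k
    by (auto simp: nil_space_def)
  with * show ?thesis by (intro exI[of _ N] allI impI subset_antisym)
qed

lemma matrix_mult_axis: "A *v axis j (1::'a::field) = column j A"
  by (simp add: vec_eq_iff matrix_vector_mult_def column_def axis_def if_distrib cong: if_cong)

text \<open>The projection onto the generalized kernel along the stable range (Fitting decomposition).\<close>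

lemma fitting_projection:
  fixes T :: "'a::field^'n^'n"
  obtains P where "P ** P = P" "P ** T = T ** P" "\<And>v. P *v v = v \<Longrightarrow> v \<in> nil_space T"
    "\<And>v. P *v v = 0 \<Longrightarrow> T *v v = 0 \<Longrightarrow> v = 0"
    "\<And>u. det (mat u ** P + (mat 1 - P)) = u ^ vec.dim (nil_space T)"
proof -
  obtain N where N: "\<And>k. k \<ge> N \<Longrightarrow> nil_space T = {v. ((*v) T ^^ k) v = 0}"
    using nil_space_eq_kernel by blast
  define F where "F = ((*v) T ^^ N)"
  have linF: "Vector_Spaces.linear (*s) (*s) F" unfolding F_def by (rule linear_funpow)
  interpret F: Vector_Spaces.linear "(*s)" "(*s)" F by (rule linF)
  let ?W = "nil_space T" and ?R = "range F"
  have W: "?W = {v. F v = 0}" using N[of N] by (simp add: F_def)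
  have subR: "vec.subspace ?R" using F.subspace_image vec.subspace_UNIV by blast
  \<comment> \<open>If \<open>F (F v) = 0\<close>, then a power of \<open>T\<close> kills
    \<open>v\<close>, so \<open>v\<close> already lies in the kernel of \<open>F\<close>: the
    kernels of the powers are stable from \<open>N\<close> on.\<close>
  have WR: "?W \<inter> ?R = {0}"
  proof -
    have *: "F v = 0" if "F (F v) = 0" for v
    proof -
      have "((*v) T ^^ (N + N)) v = 0" using that by (simp add: F_def funpow_add)
      then have "v \<in> ?W" by (auto simp: nil_space_def)
      then show ?thesis using W by simp
    qed
    have "x = 0" if x: "x \<in> ?W \<inter> ?R" for x
    proof -
      obtain v where "x = F v" "F x = 0" using x W by blast
      then show ?thesis using *[of v] by blast
    qed
    moreover have "0 \<in> ?W" using F.zero by (simp add: W)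
    moreover have "0 \<in> ?R" by (rule vec.subspace_0[OF subR])
    ultimately show ?thesis by blast
  qed
  have dims: "vec.dim ?R + vec.dim ?W = CARD('n)"
    using dim_image_plus_kernel[OF linF vec.subspace_UNIV] W by (simp add: vec_dim_card del: vec.dim_UNIV)
  have FT: "F (T *v v) = T *v F v" for v
    unfolding F_def by (simp add: funpow_swap1)
  have sum: "\<exists>w r. w \<in> ?W \<and> r \<in> ?R \<and> v = w + r" for v
  proof -
    have "vec.dim {x + y |x y. x \<in> ?W \<and> y \<in> ?R} = CARD('n)"
      using vec.dim_sums_Int[OF subspace_nil_space[of T] subR] WR dims by simp
    moreover have "vec.subspace {x + y |x y. x \<in> ?W \<and> y \<in> ?R}"
      by (rule vec.subspace_sums[OF subspace_nil_space subR])
    ultimately have "{x + y |x y. x \<in> ?W \<and> y \<in> ?R} = UNIV"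
      using vec.subspace_dim_equal[OF _ vec.subspace_UNIV] vec_dim_card[where 'n='n and 'a='a]
      by (metis (no_types, lifting) order_refl subset_UNIV)
    then show ?thesis by blast
  qed
  obtain BW where BW: "BW \<subseteq> ?W" "vec.independent BW" "?W \<subseteq> vec.span BW" "card BW = vec.dim ?W"
    by (rule vec.basis_exists)
  obtain BR where BR: "BR \<subseteq> ?R" "vec.independent BR" "?R \<subseteq> vec.span BR" "card BR = vec.dim ?R"
    by (rule vec.basis_exists)
  have finW: "finite BW" and finR: "finite BR" using BW(2) BR(2) by (simp_all add: vec.finiteI_independent)
  have disj: "BW \<inter> BR = {}"
  proof -
    have "0 \<notin> BW"
    proof
      assume "0 \<in> BW"
      then have "vec.dependent BW" by (rule vec.dependent_zero)
      then show False using BW(2) by contradiction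
    qed
    moreover have "x = 0" if "x \<in> BW" "x \<in> BR" for x
    proof -
      have "x \<in> ?W \<inter> ?R" by (rule IntI[OF subsetD[OF BW(1) that(1)] subsetD[OF BR(1) that(2)]])
      then show ?thesis unfolding WR by (rule singletonD)
    qed
    ultimately show ?thesis unfolding disjoint_iff by metis
  qed
  have cardU: "card (BW \<union> BR) = CARD('n)"
    using dims by (simp add: card_Un_disjoint disj finW finR BW(4) BR(4))
  then obtain g where g: "bij_betw g (UNIV :: 'n set) (BW \<union> BR)"
    using finW finR by (metis finite_same_card_bij finite_UnI finite_class.finite_UNIV)
  have spanU: "vec.span (BW \<union> BR) = UNIV"
  proof -
    have "v \<in> vec.span (BW \<union> BR)" for v
    proof -
      obtain w r where wr: "w \<in> ?W" "r \<in> ?R" "v = w + r" using sum by blast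
      have "w \<in> vec.span (BW \<union> BR)" using wr BW(3) vec.span_mono[of BW "BW \<union> BR"] by blast
      moreover have "r \<in> vec.span (BW \<union> BR)" using wr BR(3) vec.span_mono[of BR "BW \<union> BR"] by blast
      ultimately show ?thesis using wr by (simp add: vec.span_add)
    qed
    then show ?thesis by auto
  qed
  \<comment> \<open>The columns of \<open>Q\<close> form a basis adapted to the splitting into
    generalized kernel and stable range, and the 0/1 diagonal matrix \<open>D\<close> marks the
    former; \<open>P = Q D Q^-1\<close> makes the determinant a power of \<open>u\<close>.\<close>
  define Q where "Q = (\<chi> i j. g j $ i)"
  define S where "S = {j. g j \<in> BW}"
  define D where "D = (\<chi> i j. if i = j \<and> i \<in> S then 1 else (0::'a))"
  have colQ: "column j Q = g j" for j by (simp add: Q_def column_def vec_eq_iff)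
  have Qax: "Q *v axis j 1 = g j" for j by (simp add: matrix_mult_axis colQ)
  have "columns Q = BW \<union> BR"
    using g by (auto simp: columns_def colQ bij_betw_def)
  then obtain Q' where QQ': "Q ** Q' = mat 1"
    using matrix_right_invertible_span_columns[of Q] spanU by auto
  then have Q'Q: "Q' ** Q = mat 1" by (simp add: matrix_left_right_inverse)
  define P where "P = Q ** D ** Q'"
  have DD: "D ** D = D"
    by (simp add: D_def vec_eq_iff matrix_matrix_mult_def if_distrib[of "\<lambda>x. x * _"] cong: if_cong)
       (auto intro!: sum.neutral simp: sum.delta)
  have Dax: "D *v axis j 1 = (if j \<in> S then axis j 1 else 0)" for j
    unfolding matrix_mult_axis by (auto simp: column_def D_def vec_eq_iff axis_def)
  have Pg: "P *v g j = (if j \<in> S then g j else 0)" for j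
  proof -
    have "P *v g j = (Q ** D ** Q') *v (Q *v axis j 1)" by (simp add: P_def Qax)
    also have "\<dots> = Q *v (D *v ((Q' ** Q) *v axis j 1))"
      by (simp add: matrix_vector_mul_assoc matrix_mul_assoc)
    also have "\<dots> = (if j \<in> S then g j else 0)" by (simp add: Q'Q Dax Qax)
    finally show ?thesis .
  qed
  have PW: "P *v w = w" if "w \<in> ?W" for w
  proof -
    have "vec.span BW \<subseteq> {w. P *v w = w}"
    proof (rule vec.span_minimal)
      show "BW \<subseteq> {w. P *v w = w}"
      proof
        fix w assume "w \<in> BW"
        then obtain j where "w = g j" using g by (auto simp: bij_betw_def)
        then show "w \<in> {w. P *v w = w}" using \<open>w \<in> BW\<close> by (simp add: Pg S_def)
      qed
    qed (auto simp: vec.subspace_def vec.add vec.scale)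
    then show ?thesis using BW(3) that by blast
  qed
  have PR: "P *v r = 0" if "r \<in> ?R" for r
  proof -
    have "vec.span BR \<subseteq> {w. P *v w = 0}"
    proof (rule vec.span_minimal)
      show "BR \<subseteq> {w. P *v w = 0}"
      proof
        fix w assume "w \<in> BR"
        then obtain j where "w = g j" using g by (auto simp: bij_betw_def)
        then show "w \<in> {w. P *v w = 0}" using \<open>w \<in> BR\<close> disj by (auto simp add: Pg S_def)
      qed
    qed (auto simp: vec.subspace_def vec.add vec.scale)
    then show ?thesis using BR(3) that by blast
  qed
  have Pw: "P *v (w + r) = w" if "w \<in> ?W" "r \<in> ?R" for w r
    using that by (simp add: vec.add PW PR)
  have TW: "T *v w \<in> ?W" if "w \<in> ?W" for w
    using that by (simp add: W FT)
  have TR: "T *v r \<in> ?R" if "r \<in> ?R" for r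
    using that FT by (auto simp: FT[symmetric])
  have 1: "P ** P = P"
  proof -
    have "P ** P = Q ** D ** (Q' ** Q) ** D ** Q'" by (simp add: P_def matrix_mul_assoc)
    also have "\<dots> = Q ** (D ** D) ** Q'" by (simp add: Q'Q matrix_mul_assoc)
    finally show ?thesis by (simp add: DD P_def)
  qed
  have 2: "P ** T = T ** P"
  proof (unfold matrix_eq, rule allI)
    fix v
    obtain w r where wr: "w \<in> ?W" "r \<in> ?R" "v = w + r" using sum by blast
    have "P *v (T *v v) = T *v w" using wr Pw[OF TW TR] by (simp add: vec.add)
    also have "\<dots> = T *v (P *v v)" using wr Pw by simp
    finally show "P ** T *v v = T ** P *v v" by (simp add: matrix_vector_mul_assoc)
  qed
  have 3: "v \<in> ?W" if "P *v v = v" for v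
  proof -
    obtain w r where wr: "w \<in> ?W" "r \<in> ?R" "v = w + r" using sum by blast
    then show ?thesis using that Pw by simp
  qed
  have 4: "v = 0" if "P *v v = 0" "T *v v = 0" for v
  proof -
    obtain w r where wr: "w \<in> ?W" "r \<in> ?R" "v = w + r" using sum by blast
    then have "v = r" using that Pw by simp
    moreover have "v \<in> ?W" using that(2) by (auto simp: nil_space_def intro!: exI[of _ 1])
    ultimately show ?thesis using wr WR by blast
  qed
  have 5: "det (mat u ** P + (mat 1 - P)) = u ^ vec.dim ?W" for u
  proof -
    have "mat u ** P + (mat 1 - P) = Q ** (mat u ** D + (mat 1 - D)) ** Q'"
    proof (unfold matrix_eq, rule allI)
      fix x
      have "Q *v (Q' *v x) = x" by (simp add: matrix_vector_mul_assoc QQ')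
      then show "(mat u ** P + (mat 1 - P)) *v x = Q ** (mat u ** D + (mat 1 - D)) ** Q' *v x"
        by (simp add: P_def matrix_vector_mul_assoc[symmetric] matrix_vector_mult_add_rdistrib
            matrix_vector_mult_diff_rdistrib mat_mult_vec vec.add vec.diff vec.scale)
    qed
    then have "det (mat u ** P + (mat 1 - P)) = det (Q ** Q') * det (mat u ** D + (mat 1 - D))"
      by (simp add: det_mul)
    also have "\<dots> = det (mat u ** D + (mat 1 - D))" by (simp add: QQ')
    also have "mat u ** D + (mat 1 - D) = (\<chi> i j. if i = j then (if i \<in> S then u else 1) else 0)"
      by (auto simp: vec_eq_iff matrix_matrix_mult_def mat_def D_def if_distrib[of "\<lambda>x. x * _"] cong: if_cong)
    also have "det \<dots> = (\<Prod>i\<in>UNIV. if i \<in> S then u else 1)"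
      by (subst det_diagonal) auto
    also have "\<dots> = u ^ card S"
      by (simp add: prod.If_cases)
    also have "card S = card BW"
    proof -
      have "bij_betw g S BW"
        unfolding bij_betw_def
      proof
        show "inj_on g S" using g by (auto simp: bij_betw_def intro: inj_on_subset)
        have "BW \<subseteq> range g" using g by (auto simp: bij_betw_def)
        then show "g ` S = BW" unfolding S_def by blast
      qed
      then show ?thesis by (rule bij_betw_same_card)
    qed
    finally show ?thesis by (simp only: BW(4))
  qed
  show ?thesis using that[OF 1 2 3 4 5] .
qed

section \<open>Determinant of a local pencil and the generalized kernel\<close>

lemma poly_det: "poly (det M) u = det (\<chi> i j. poly (M $ i $ j) u)"
  for M :: "'a::comm_ring_1 poly^'n^'n"
  by (simp add: det_def poly_sum poly_prod)

lemma mat_mult_nth: "(mat u ** A) $ i $ j = u * (A $ i $ j :: 'a::comm_ring_1)"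
  by (simp add: matrix_matrix_mult_def mat_def if_distrib[of "\<lambda>x. x * _"] cong: if_cong)

text \<open>As a polynomial in \<open>a\<close> the determinant has no complex root, since a kernel
  vector would satisfy \<open>v = a^j N^j v\<close> for all \<open>j\<close>; hence it is constant,
  with value 1 at \<open>a = 0\<close>.\<close>

lemma det_one_minus_nilpotent:
  fixes N :: "complex^'n^'n"
  assumes N: "\<And>v. ((*v) N ^^ k) v = 0"
  shows "det (mat 1 - mat a ** N) = 1"
proof -
  define D where "D = det (\<chi> i j. [:if i = j then 1 else 0, - (N $ i $ j):])"
  have D: "poly D a = det (mat 1 - mat a ** N)" for a
  proof -
    have "(\<chi> i j. (if i = j then 1 else 0) - a * N $ i $ j) = mat 1 - mat a ** N"
      by (simp add: vec_eq_iff mat_mult_nth) (simp add: mat_def)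
    then show ?thesis by (simp add: D_def poly_det if_distrib[of "\<lambda>x. x + _"] cong: if_cong)
  qed
  have "poly D a \<noteq> 0" for a
  proof -
    have "v = 0" if v: "(mat 1 - mat a ** N) *v v = 0" for v
    proof -
      have "v = a *s (N *v v)"
        using v by (simp add: matrix_vector_mult_diff_rdistrib matrix_vector_mul_assoc[symmetric] mat_mult_vec)
      then have "((*v) N ^^ j) v = ((*v) N ^^ j) (a *s (N *v v))" for j
        by (rule arg_cong)
      also have "((*v) N ^^ j) (a *s (N *v v)) = a *s ((*v) N ^^ Suc j) v" for j
        unfolding module_hom.scale[OF linear_funpow[of j N, unfolded Vector_Spaces.linear_iff_module_hom]]
        by (simp only: funpow_Suc_right comp_apply)
      finally have step: "((*v) N ^^ j) v = a *s ((*v) N ^^ Suc j) v" for j .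
      have "v = a ^ j *s ((*v) N ^^ j) v" for j
      proof (induction j)
        case (Suc j)
        have "a ^ Suc j *s ((*v) N ^^ Suc j) v = a ^ j *s (a *s ((*v) N ^^ Suc j) v)"
          by (simp only: vec.scale_scale power_Suc2)
        also have "\<dots> = a ^ j *s ((*v) N ^^ j) v" by (simp only: step[symmetric])
        finally show ?case using Suc.IH by (simp only:)
      qed simp
      from this[of k] show ?thesis using N by simp
    qed
    then have "invertible (mat 1 - mat a ** N)" by (simp add: invertible_iff_kernel)
    then show ?thesis by (simp add: D invertible_det_nz)
  qed
  then have "degree D = 0" using alg_closed_imp_poly_has_root[of D] by blast
  then have "poly D a = poly D 0" by (auto elim!: degree_eq_zeroE)
  then show ?thesis by (simp add: D)
qed

lemmas mat_vec_simps = matrix_vector_mul_assoc[symmetric] matrix_vector_mult_add_rdistrib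
  matrix_vector_mult_diff_rdistrib mat_mult_vec vec.add vec.diff vec.scale

text \<open>From \<open>Y = Z - c X\<close> and \<open>X = Z T\<close> one gets
  \<open>u Y - X = Z (u - (1 + c u) T)\<close>. On the generalized kernel of \<open>T\<close> the
  factor behind \<open>Z\<close> is \<open>u\<close> times a unipotent map; on the complement it is
  affine in \<open>u\<close> and invertible at \<open>u = 0\<close>. The power of \<open>u\<close>
  comes from the first part, \<open>g\<close> from the second and \<open>det Z\<close>.\<close>

lemma det_pencil_factor:
  fixes X Y Z T :: "complex^'n^'n"
  assumes Z: "invertible Z" "Z = Y + mat c ** X" "Z ** T = X"
  obtains g where "poly g 0 \<noteq> 0"
    "\<And>u. u \<noteq> 0 \<Longrightarrow> det (mat u ** Y - X) = u ^ vec.dim (nil_space T) * poly g u"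
proof -
  obtain P where P: "P ** P = P" "P ** T = T ** P" "\<And>v. P *v v = v \<Longrightarrow> v \<in> nil_space T"
    "\<And>v. P *v v = 0 \<Longrightarrow> T *v v = 0 \<Longrightarrow> v = 0"
    "\<And>u. det (mat u ** P + (mat 1 - P)) = u ^ vec.dim (nil_space T)"
    using fitting_projection[of T] by metis
  have PP: "P *v (P *v v) = P *v v" and PT: "P *v (T *v v) = T *v (P *v v)"
    and ZT: "Z *v (T *v v) = X *v v" for v
    using P(1,2) Z(3) by (simp_all add: matrix_vector_mul_assoc)
  have Zv: "Z *v v = Y *v v + c *s (X *v v)" for v
    by (simp add: Z(2) mat_vec_simps)
  have YT: "Y *v (T *v v) = X *v v - c *s (X *v (T *v v))" for v
    using ZT[of v] unfolding Zv by (simp add: algebra_simps)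
  define B where "B = T ** (mat 1 - P)"
  \<comment> \<open>\<open>G u\<close> is the identity on the range of \<open>P\<close> and
    \<open>u - (1 + c u) T\<close> on the kernel of \<open>P\<close>; its entries are affine in
    \<open>u\<close>, so its determinant is a polynomial \<open>H\<close>.\<close>
  define G where "G u = (P - B) + mat u ** (mat 1 - P - mat c ** B)" for u
  define H where "H = det (\<chi> i j. [:(P - B) $ i $ j, (mat 1 - P - mat c ** B) $ i $ j:])"
  have H: "poly H u = det (G u)" for u
  proof -
    have "(\<chi> i j. (P - B) $ i $ j + u * (mat 1 - P - mat c ** B) $ i $ j) = G u"
      unfolding G_def
      by (simp add: vec_eq_iff mat_mult_nth)
    then show ?thesis unfolding H_def poly_det by simp
  qed
  have 1: "poly (smult (det Z) H) 0 \<noteq> 0"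
  proof -
    have "v = 0" if "G 0 *v v = 0" for v
    proof -
      have e: "P *v v = T *v (v - P *v v)"
        using that by (simp add: G_def B_def mat_vec_simps)
      then have "P *v (P *v v) = P *v (T *v (v - P *v v))" by simp
      then have Pv: "P *v v = 0" by (simp add: PP PT vec.diff)
      with e have "T *v v = 0" by simp
      then show ?thesis using P(4) Pv by blast
    qed
    then have "invertible (G 0)" by (simp add: invertible_iff_kernel)
    then show ?thesis using Z(1) by (simp add: H invertible_det_nz)
  qed
  obtain N where N: "nil_space T = {v. ((*v) T ^^ N) v = 0}"
    using nil_space_eq_kernel[of T] by blast
  \<comment> \<open>\<open>Suc k\<close>, because the zeroth power of \<open>P T\<close> is the
    identity and not \<open>P\<close>.\<close>
  have PTpow: "((*v) (P ** T) ^^ Suc k) v = P *v ((*v) T ^^ Suc k) v" for k v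
    by (induction k) (simp_all add: matrix_vector_mul_assoc[symmetric] PP PT[symmetric])
  have "((*v) (P ** T) ^^ Suc N) v = 0" for v
  proof -
    have Pc: "P *v ((*v) T ^^ k) v = ((*v) T ^^ k) (P *v v)" for k
      by (induction k) (simp_all add: PT)
    have "P *v v \<in> nil_space T" using P(3) PP by blast
    then have "((*v) T ^^ N) (P *v v) = 0" using N by simp
    then have "((*v) T ^^ Suc N) (P *v v) = 0" by simp
    then show ?thesis unfolding PTpow Pc .
  qed
  note nil = det_one_minus_nilpotent[OF this]
  have 2: "det (mat u ** Y - X) = u ^ vec.dim (nil_space T) * poly (smult (det Z) H) u" if "u \<noteq> 0" for u
  proof -
    \<comment> \<open>On the generalized kernel \<open>u - (1 + c u) T = u (1 - a T)\<close>; this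
      is where \<open>u\<close> must not vanish.\<close>
    define a where "a = (1 + c * u) / u"
    have ua: "u * a = 1 + c * u" using that by (simp add: a_def)
    have "mat u ** Y - X = Z ** ((mat u ** P + (mat 1 - P)) ** (mat 1 - mat a ** (P ** T)) ** G u)"
    proof (unfold matrix_eq, rule allI)
      fix v
      have PG: "P *v (G u *v v) = P *v v"
        by (simp add: G_def B_def mat_vec_simps PP PT)
      have "(mat u ** P + (mat 1 - P)) *v ((mat 1 - mat a ** (P ** T)) *v (G u *v v))
          = u *s (P *v v) + (G u *v v - P *v v) - (u * a) *s (T *v (P *v v))"
        by (simp add: mat_vec_simps PP PT PG vec.scale_right_diff_distrib)
      also have "\<dots> = u *s v - (1 + c * u) *s (T *v v)"
        unfolding ua by (simp add: G_def B_def mat_vec_simps vec.scale_right_diff_distrib vec.scale_left_distrib mult.commute)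
      finally have *: "(mat u ** P + (mat 1 - P)) *v ((mat 1 - mat a ** (P ** T)) *v (G u *v v))
          = u *s v - (1 + c * u) *s (T *v v)" .
      have "Z *v (u *s v - (1 + c * u) *s (T *v v)) = u *s (Y *v v) - X *v v"
        by (simp add: vec.diff vec.add vec.scale Zv YT vec.scale_right_distrib vec.scale_right_diff_distrib vec.scale_left_distrib mult.commute)
      then show "(mat u ** Y - X) *v v = Z ** ((mat u ** P + (mat 1 - P)) ** (mat 1 - mat a ** (P ** T)) ** G u) *v v"
        unfolding matrix_vector_mul_assoc[symmetric] * by (simp add: mat_vec_simps)
    qed
    then show ?thesis by (simp add: det_mul P(5) nil H)
  qed
  show ?thesis using that[OF 1 2] .
qed

section \<open>Jordan chains and root subspaces\<close>

definition chain :: "'a::field^'n^'n \<Rightarrow> 'a^'n^'n \<Rightarrow> ('a^'n) list \<Rightarrow> bool" where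
  "chain X Y gs \<longleftrightarrow> gs \<noteq> [] \<and> gs ! 0 \<noteq> 0 \<and> X *v (gs ! 0) = 0 \<and>
     (\<forall>k. 1 \<le> k \<and> k < length gs \<longrightarrow> X *v (gs ! k) = Y *v (gs ! (k - 1)))"

lemma funpow_mult_linear:
  fixes T :: "'a::field^'n^'n"
  shows "((*v) T ^^ j) (x + y) = ((*v) T ^^ j) x + ((*v) T ^^ j) y"
    "((*v) T ^^ j) (x - y) = ((*v) T ^^ j) x - ((*v) T ^^ j) y"
    "((*v) T ^^ j) (a *s x) = a *s ((*v) T ^^ j) x"
  by (rule module_hom.add[OF linear_funpow[of j T, unfolded Vector_Spaces.linear_iff_module_hom]]
      module_hom.diff[OF linear_funpow[of j T, unfolded Vector_Spaces.linear_iff_module_hom]]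
      module_hom.scale[OF linear_funpow[of j T, unfolded Vector_Spaces.linear_iff_module_hom]])+

lemma subspace_funpow_kernel: "vec.subspace {v. ((*v) (T :: 'a::field^'n^'n) ^^ k) v = 0}"
  by (auto simp: vec.subspace_def funpow_mult_linear)

lemma funpow_mult_comm: "((*v) (T :: 'a::field^'n^'n) ^^ j) (T *v v) = T *v ((*v) T ^^ j) v"
  by (simp add: funpow_swap1)

text \<open>The kernels of the powers grow strictly up to \<open>Suc j\<close>: \<open>v\<close>
  shows that the last inclusion is strict, and \<open>T v\<close> serves for the earlier
  ones.\<close>

lemma dim_funpow_kernel_ge:
  fixes T :: "'a::field^'n^'n"
  assumes "((*v) T ^^ j) v \<noteq> 0" "((*v) T ^^ Suc j) v = 0"
  shows "Suc j \<le> vec.dim {v. ((*v) T ^^ Suc j) v = 0}"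
  using assms
proof (induction j arbitrary: v)
  case 0
  have "vec.dim {v. ((*v) T ^^ Suc 0) v = 0} \<noteq> 0"
    unfolding vec.dim_eq_0 using 0 by auto
  then show ?case by linarith
next
  case (Suc j)
  have "Suc j \<le> vec.dim {v. ((*v) T ^^ Suc j) v = 0}"
    by (rule Suc.IH[of "T *v v"]) (use Suc.prems in \<open>simp_all add: funpow_mult_comm\<close>)
  moreover have "vec.dim {v. ((*v) T ^^ Suc j) v = 0} < vec.dim {v. ((*v) T ^^ Suc (Suc j)) v = 0}"
  proof -
    let ?K = "\<lambda>k. {v. ((*v) T ^^ k) v = 0}"
    have sub: "?K (Suc j) \<subseteq> ?K (Suc (Suc j))"
      by (rule Collect_mono) (simp add: funpow_zero_mono)
    have "v \<in> ?K (Suc (Suc j))" "v \<notin> ?K (Suc j)" using Suc.prems by (simp_all only: mem_Collect_eq not_False_eq_True)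
    then have "?K (Suc j) \<noteq> ?K (Suc (Suc j))" by metis
    with sub have "?K (Suc j) \<subset> ?K (Suc (Suc j))" by (rule psubsetI)
    then have "vec.span (?K (Suc j)) \<subset> vec.span (?K (Suc (Suc j)))"
      unfolding vec.span_eq_iff[THEN iffD2, OF subspace_funpow_kernel] .
    then show ?thesis by (rule vec.dim_psubset)
  qed
  ultimately show ?case by linarith
qed

text \<open>\<open>T\<close> maps the kernel of the power \<open>Suc k\<close> into that of the
  power \<open>k\<close> and loses at most the kernel of \<open>T\<close>, so each step adds at most
  one dimension.\<close>

lemma dim_funpow_kernel_le:
  fixes T :: "'a::field^'n^'n"
  assumes "vec.dim {v. T *v v = 0} \<le> 1"
  shows "vec.dim {v. ((*v) T ^^ k) v = 0} \<le> k"
proof (induction k)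
  case 0
  have "vec.dim {v. ((*v) T ^^ 0) v = 0} = 0" unfolding vec.dim_eq_0 by auto
  then show ?case by linarith
next
  case (Suc k)
  let ?V = "{v. ((*v) T ^^ Suc k) v = 0}"
  have "vec.dim ((*v) T ` ?V) + vec.dim {v \<in> ?V. T *v v = 0} = vec.dim ?V"
    by (rule dim_image_plus_kernel[OF matrix_vector_mul_linear_gen subspace_funpow_kernel])
  moreover have "vec.dim ((*v) T ` ?V) \<le> vec.dim {v. ((*v) T ^^ k) v = 0}"
    by (rule vec.dim_subset) (auto simp: funpow_mult_comm)
  moreover have "vec.dim {v \<in> ?V. T *v v = 0} \<le> vec.dim {v. T *v v = 0}"
    by (rule vec.dim_subset) auto
  ultimately show ?case using assms Suc.IH by linarith
qed

text \<open>On the generalized kernel \<open>1 - c T\<close> is unipotent, hence invertible.\<close>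

lemma one_minus_nilpotent_solve:
  fixes T :: "'a::field^'n^'n"
  assumes "((*v) T ^^ m) x = 0"
  shows "\<exists>w. w - c *s (T *v w) = x \<and> (\<forall>j. ((*v) T ^^ j) x = 0 \<longrightarrow> ((*v) T ^^ j) w = 0)"
  using assms
proof (induction m arbitrary: x)
  case 0
  then show ?case by (intro exI[of _ 0]) simp
next
  case (Suc m)
  then have "((*v) T ^^ m) (T *v x) = 0" by (simp add: funpow_mult_comm)
  then obtain w where w: "w - c *s (T *v w) = T *v x"
    "\<And>j. ((*v) T ^^ j) (T *v x) = 0 \<Longrightarrow> ((*v) T ^^ j) w = 0"
    using Suc.IH by blast
  have "(x + c *s w) - c *s (T *v (x + c *s w)) = x + c *s ((w - c *s (T *v w)) - T *v x)"
    by (simp add: vec.add vec.scale vec.scale_right_distrib vec.scale_right_diff_distrib)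
  then have "(x + c *s w) - c *s (T *v (x + c *s w)) = x" unfolding w(1) by simp
  moreover have "((*v) T ^^ j) (x + c *s w) = 0" if "((*v) T ^^ j) x = 0" for j
    using that w(2)[of j] by (simp add: funpow_mult_linear funpow_mult_comm)
  ultimately show ?case by blast
qed

context
  fixes X Y Z T :: "'a::field^'n^'n" and c :: 'a
  assumes Z: "invertible Z" "Z = Y + mat c ** X" "Z ** T = X"
begin

text \<open>Cancelling \<open>Z\<close> turns a step of a pencil chain into a step for
  \<open>T\<close> alone, up to the factor \<open>1 - c T\<close>, which is unipotent on the
  generalized kernel.\<close>

lemma chain_step_iff: "X *v v = Y *v w \<longleftrightarrow> T *v v = w - c *s (T *v w)"
proof -
  have Zv: "Z *v v = Y *v v + c *s (X *v v)" and ZT: "Z *v (T *v v) = X *v v" for v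
    using arg_cong[OF Z(2), of "\<lambda>M. M *v v"] arg_cong[OF Z(3), of "\<lambda>M. M *v v"]
    by (simp_all only: matrix_vector_mult_add_rdistrib matrix_vector_mul_assoc[symmetric] mat_mult_vec)
  have inj: "Z *v p = Z *v q \<longleftrightarrow> p = q" for p q
    using Z(1)[unfolded invertible_iff_kernel, rule_format, of "p - q"] by (auto simp: vec.diff)
  have "Z *v (w - c *s (T *v w)) = Y *v w"
    by (simp add: vec.diff vec.scale ZT) (simp add: Zv)
  then show ?thesis using inj[of "T *v v" "w - c *s (T *v w)"] ZT[of v] by simp
qed

lemma kernel_iff: "X *v v = 0 \<longleftrightarrow> T *v v = 0"
  using chain_step_iff[of v 0] by simp

text \<open>In the step \<open>T g_(j+1) = g_j - c T g_j\<close> the correction is annihilated by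
  one power of \<open>T\<close> less than \<open>g_j\<close>, so the exact nilpotency exponent grows
  by one along a chain.\<close>

lemma chain_nth_funpow:
  assumes "chain X Y gs" "j < length gs"
  shows "((*v) T ^^ Suc j) (gs ! j) = 0 \<and> ((*v) T ^^ j) (gs ! j) \<noteq> 0"
  using assms(2)
proof (induction j)
  case 0
  then show ?case using assms(1) by (simp add: chain_def kernel_iff)
next
  case (Suc j)
  have "X *v (gs ! Suc j) = Y *v (gs ! j)"
    using assms(1) Suc.prems unfolding chain_def by (metis diff_Suc_1 le_add1 plus_1_eq_Suc)
  then have Tg: "T *v (gs ! Suc j) = gs ! j - c *s (T *v (gs ! j))"
    by (simp only: chain_step_iff)
  have 1: "((*v) T ^^ Suc k) (gs ! Suc j) = ((*v) T ^^ k) (gs ! j) - c *s ((*v) T ^^ Suc k) (gs ! j)" for k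
    by (simp add: funpow_mult_comm[symmetric] Tg funpow_mult_linear)
  have IH: "((*v) T ^^ Suc j) (gs ! j) = 0" "((*v) T ^^ j) (gs ! j) \<noteq> 0"
    using Suc.IH Suc.prems by auto
  then have "((*v) T ^^ Suc (Suc j)) (gs ! j) = 0" by simp
  then show ?case using IH unfolding 1 by simp
qed

lemma chain_snoc:
  assumes "chain X Y gs" "X *v v = Y *v last gs"
  shows "chain X Y (gs @ [v])"
  unfolding chain_def
proof (intro conjI allI impI)
  show "gs @ [v] \<noteq> []" by simp
  show "(gs @ [v]) ! 0 \<noteq> 0" "X *v ((gs @ [v]) ! 0) = 0"
    using assms(1) by (auto simp: chain_def nth_append)
  fix k assume k: "1 \<le> k \<and> k < length (gs @ [v])"
  show "X *v ((gs @ [v]) ! k) = Y *v ((gs @ [v]) ! (k - 1))"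
  proof (cases "k = length gs")
    case True
    moreover have "gs \<noteq> []" using assms(1) by (simp add: chain_def)
    ultimately have "(gs @ [v]) ! (k - 1) = last gs"
      using k by (auto simp: nth_append last_conv_nth[of gs])
    then show ?thesis using True assms(2) by simp
  next
    case False
    then have "k < length gs" using k by simp
    then show ?thesis using assms(1) k by (auto simp: nth_append chain_def)
  qed
qed

text \<open>The chain is built downwards from its last element \<open>v\<close>: the predecessor
  \<open>w\<close> solves \<open>(1 - c T) w = T v\<close>, and as \<open>1 - c T\<close> preserves
  nilpotency exponents, that of \<open>w\<close> is one less than that of \<open>v\<close>.\<close>

lemma chain_exists:
  assumes "((*v) T ^^ j) v \<noteq> 0" "((*v) T ^^ Suc j) v = 0"
  shows "\<exists>gs. chain X Y gs \<and> last gs = v \<and> length gs = Suc j"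
  using assms
proof (induction j arbitrary: v)
  case 0
  then show ?case by (intro exI[of _ "[v]"]) (simp add: chain_def kernel_iff)
next
  case (Suc j)
  have "((*v) T ^^ Suc j) (T *v v) = 0" using Suc.prems(2) by (simp add: funpow_mult_comm)
  then obtain w where w: "w - c *s (T *v w) = T *v v" "((*v) T ^^ Suc j) w = 0"
    using one_minus_nilpotent_solve by blast
  have "((*v) T ^^ j) w \<noteq> 0"
  proof
    assume a: "((*v) T ^^ j) w = 0"
    have "((*v) T ^^ Suc j) v = ((*v) T ^^ j) (w - c *s (T *v w))"
      unfolding w(1) by (simp add: funpow_mult_comm)
    also have "\<dots> = 0" by (simp add: funpow_mult_linear funpow_mult_comm a)
    finally show False using Suc.prems by blast
  qed
  from Suc.IH[OF this w(2)] obtain gs where gs: "chain X Y gs" "last gs = w" "length gs = Suc j"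
    by blast
  have "X *v v = Y *v last gs" unfolding gs(2) chain_step_iff w(1) ..
  then show ?case using chain_snoc[OF gs(1)] gs by (intro exI[of _ "gs @ [v]"]) simp
qed

lemma nilpotency_index:
  assumes "v \<in> nil_space T" "v \<noteq> 0"
  obtains j where "((*v) T ^^ j) v \<noteq> 0" "((*v) T ^^ Suc j) v = 0"
proof -
  obtain k where "((*v) T ^^ k) v = 0" using assms by (auto simp: nil_space_def)
  then obtain j where "((*v) T ^^ j) v \<noteq> 0" "((*v) T ^^ Suc j) v = 0"
    using assms(2) dec_induct[of 0 k "\<lambda>j. ((*v) T ^^ j) v \<noteq> 0"] by auto
  then show ?thesis using that by blast
qed

text \<open>A root subspace is defined as a union of chains; this shows it to be a genuine subspace.
  Every nonzero vector of the generalized kernel is the last element of a chain.\<close>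

lemma chain_set_eq_nil_space: "{0} \<union> \<Union> {set gs |gs. chain X Y gs} = nil_space T"
proof (intro equalityI subsetI)
  fix v assume "v \<in> {0} \<union> \<Union> {set gs |gs. chain X Y gs}"
  then consider "v = 0" | gs j where "chain X Y gs" "j < length gs" "v = gs ! j"
    by (auto simp: in_set_conv_nth)
  then show "v \<in> nil_space T"
  proof cases
    case 1
    then show ?thesis by (auto simp: nil_space_def)
  next
    case 2
    then have "((*v) T ^^ Suc j) v = 0" using chain_nth_funpow by blast
    then show ?thesis unfolding nil_space_def by blast
  qed
next
  fix v assume v: "v \<in> nil_space T"
  show "v \<in> {0} \<union> \<Union> {set gs |gs. chain X Y gs}"
  proof (cases "v = 0")
    case False
    then obtain j where "((*v) T ^^ j) v \<noteq> 0" "((*v) T ^^ Suc j) v = 0"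
      using nilpotency_index v by blast
    then obtain gs where "chain X Y gs" "last gs = v" using chain_exists by blast
    moreover from this have "v \<in> set gs" by (auto simp: chain_def)
    ultimately show ?thesis by blast
  qed simp
qed

lemma chain_length_le: "chain X Y gs \<Longrightarrow> length gs \<le> vec.dim (nil_space T)"
proof -
  assume gs: "chain X Y gs"
  then obtain j where j: "length gs = Suc j" by (cases gs) (auto simp: chain_def)
  have "Suc j \<le> vec.dim {v. ((*v) T ^^ Suc j) v = 0}"
    using chain_nth_funpow[OF gs, of j] unfolding j by (intro dim_funpow_kernel_ge[of j T "gs ! j"]) blast+
  also have "\<dots> \<le> vec.dim (nil_space T)"
    by (rule vec.dim_subset) (unfold nil_space_def, blast)
  finally show ?thesis using j by simp
qed

text \<open>Let \<open>j\<close> be the least power whose kernel is the generalized kernel. A vector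
  outside the previous kernel ends a chain of length \<open>j\<close>, while a kernel of dimension
  at most one bounds the dimension by \<open>j\<close>.\<close>

lemma chain_length_ge:
  assumes "nil_space T \<noteq> {0}" "vec.dim {v. X *v v = 0} \<le> 1"
  shows "\<exists>gs. chain X Y gs \<and> vec.dim (nil_space T) \<le> length gs"
proof -
  define K where "K k = {v. ((*v) T ^^ k) v = 0}" for k
  obtain N where N: "nil_space T = K N" unfolding K_def using nil_space_eq_kernel[of T] by blast
  define j where "j = (LEAST k. nil_space T = K k)"
  have j: "nil_space T = K j" unfolding j_def using N by (rule LeastI)
  have "K 0 = {0}" by (simp add: K_def)
  then have "j \<noteq> 0" using j assms(1) by metis
  then obtain i where i: "j = Suc i" by (cases j) auto
  have "nil_space T \<noteq> K i" using not_less_Least[of i "\<lambda>k. nil_space T = K k"] i j_def by simp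
  moreover have "K i \<subseteq> nil_space T" by (auto simp: K_def nil_space_def)
  ultimately obtain v where "v \<in> K (Suc i)" "v \<notin> K i" unfolding j i by blast
  then have "((*v) T ^^ i) v \<noteq> 0" "((*v) T ^^ Suc i) v = 0" unfolding K_def by blast+
  from chain_exists[OF this] obtain gs where gs: "chain X Y gs" "length gs = Suc i" by blast
  have "vec.dim (nil_space T) \<le> j"
    unfolding j K_def by (rule dim_funpow_kernel_le) (use assms(2) in \<open>simp add: kernel_iff\<close>)
  with gs show ?thesis unfolding i by (intro exI[of _ gs] conjI) (simp_all only:)
qed

end

section \<open>Dimensions of root subspaces from the determinant polynomial\<close>

lemma poly_eq_ext:
  fixes p q :: "'a::{idom,ring_char_0} poly"
  assumes "\<And>s. poly p s = poly q s"
  shows "p = q"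
proof -
  have "poly p = poly q" by (rule ext) (rule assms)
  then show ?thesis by (simp only: poly_eq_poly_eq_iff)
qed

lemma poly_eqI_off_roots:
  fixes p q r :: "'a::{idom,ring_char_0} poly"
  assumes "r \<noteq> 0" "\<And>s. poly r s \<noteq> 0 \<Longrightarrow> poly p s = poly q s"
  shows "p = q"
proof -
  have "poly (r * p) s = poly (r * q) s" for s
    using assms(2)[of s] by (cases "poly r s = 0") simp_all
  then have "r * p = r * q" by (rule poly_eq_ext)
  then show ?thesis using assms(1) unfolding mult_cancel_left by simp
qed

lemma poly_eq_if_eq_off_point:
  fixes p q :: "'a::{idom,ring_char_0} poly"
  assumes "\<And>s. s \<noteq> z \<Longrightarrow> poly p s = poly q s"
  shows "p = q"
  by (rule poly_eqI_off_roots[of "[:- z, 1:]"]) (use assms in auto)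

definition pencil_det :: "complex^'n^'n \<Rightarrow> complex^'n^'n \<Rightarrow> complex poly" where
  "pencil_det E A = det (\<chi> i j. [:- (A $ i $ j), E $ i $ j:])"

lemma poly_pencil_det: "poly (pencil_det E A) s = det (pencil_at E A (Fin s))"
  by (simp add: pencil_det_def poly_det)

lemma regular_pencil_iff: "regular_pencil E A \<longleftrightarrow> pencil_det E A \<noteq> 0"
  by (simp add: regular_pencil_def pencil_det_def)

lemma det_mat_mult: "det (mat c ** M) = c ^ CARD('n) * det (M :: complex^'n^'n)"
proof -
  have "det (mat c :: complex^'n^'n) = c ^ CARD('n)"
    by (subst det_diagonal) (simp_all add: mat_def)
  then show ?thesis by (simp add: det_mul)
qed

text \<open>The Jordan chains at a point are the chains at \<open>u = 0\<close> of the local pencil \<open>u Y - X\<close>, with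
  \<open>X = local_coeff\<close> and \<open>Y = local_lead\<close>.\<close>

fun local_coeff :: "complex^'n^'n \<Rightarrow> complex^'n^'n \<Rightarrow> ext_complex \<Rightarrow> complex^'n^'n" where
  "local_coeff E A (Fin z) = (\<chi> i j. A $ i $ j - z * E $ i $ j)"
| "local_coeff E A Infty = E"

fun local_lead :: "complex^'n^'n \<Rightarrow> complex^'n^'n \<Rightarrow> ext_complex \<Rightarrow> complex^'n^'n" where
  "local_lead E A (Fin z) = E"
| "local_lead E A Infty = A"

lemma jordan_chain_iff: "jordan_chain E A x gs \<longleftrightarrow> chain (local_coeff E A x) (local_lead E A x) gs"
  by (cases x) (simp_all add: chain_def)

lemma local_coeff_kernel: "local_coeff E A x *v v = 0 \<longleftrightarrow> pencil_at E A x *v v = 0"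
proof (cases x)
  case (Fin z)
  have "pencil_at E A x *v v = - (local_coeff E A x *v v)"
    unfolding Fin by (simp add: vec_eq_iff matrix_vector_mult_def sum_negf[symmetric] algebra_simps)
  then show ?thesis by simp
qed simp

text \<open>Up to a nonzero scalar \<open>Z\<close> is the pencil at a point \<open>s\<close>, so a
  suitable non-root \<open>s\<close> of the determinant yields \<open>c\<close>.\<close>

lemma local_pencil_invertible:
  assumes "regular_pencil E A"
  obtains c Z T where "invertible Z" "Z = local_lead E A x + mat c ** local_coeff E A x"
    "Z ** T = local_coeff E A x"
proof -
  have "pencil_det E A \<noteq> 0" using assms by (simp add: regular_pencil_iff)
  then have fin: "finite {s. poly (pencil_det E A) s = 0}" by (rule poly_roots_finite)
  have "\<exists>c. invertible (local_lead E A x + mat c ** local_coeff E A x)"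
  proof (cases x)
    case (Fin z)
    have "\<exists>s. s \<notin> insert z {s. poly (pencil_det E A) s = 0}"
      by (rule ex_new_if_finite[OF infinite_UNIV_char_0]) (use fin in simp)
    then obtain s where s: "s \<noteq> z" "poly (pencil_det E A) s \<noteq> 0" by blast
    \<comment> \<open>Chosen so that \<open>E + c (A - z E) = - c (s E - A)\<close>.\<close>
    define c where "c = 1 / (z - s)"
    have cz: "c * (z - s) = 1" using s by (simp add: c_def)
    then have cz': "1 - c * z = - c * s" by (simp add: algebra_simps)
    have "local_lead E A x + mat c ** local_coeff E A x = mat (- c) ** pencil_at E A (Fin s)"
    proof -
      have "e + c * (a - z * e) = - c * (s * e - a)" for e a
      proof -
        have "e + c * (a - z * e) = (1 - c * z) * e + c * a" by (simp add: algebra_simps)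
        then show ?thesis unfolding cz' by (simp add: algebra_simps)
      qed
      then show ?thesis unfolding Fin by (simp add: vec_eq_iff mat_mult_nth)
    qed
    moreover have "c \<noteq> 0" using cz by auto
    ultimately have "det (local_lead E A x + mat c ** local_coeff E A x) \<noteq> 0"
      using s(2) unfolding poly_pencil_det by (simp only: det_mat_mult) simp
    then show ?thesis by (intro exI[of _ c]) (simp add: invertible_det_nz)
  next
    case Infty
    have "\<exists>s. s \<notin> {s. poly (pencil_det E A) s = 0}"
      by (rule ex_new_if_finite[OF infinite_UNIV_char_0 fin])
    then obtain s where s: "poly (pencil_det E A) s \<noteq> 0" by blast
    have "local_lead E A x + mat (- s) ** local_coeff E A x = mat (- 1) ** pencil_at E A (Fin s)"
      unfolding Infty by (simp add: vec_eq_iff mat_mult_nth)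
    then have "det (local_lead E A x + mat (- s) ** local_coeff E A x) \<noteq> 0"
      using s unfolding poly_pencil_det by (simp only: det_mat_mult) simp
    then show ?thesis by (intro exI[of _ "- s"]) (simp add: invertible_det_nz)
  qed
  then obtain c where c: "invertible (local_lead E A x + mat c ** local_coeff E A x)" by blast
  then obtain Z' where "(local_lead E A x + mat c ** local_coeff E A x) ** Z' = mat 1"
    unfolding invertible_right_inverse by blast
  then have "(local_lead E A x + mat c ** local_coeff E A x) ** (Z' ** local_coeff E A x) = local_coeff E A x"
    by (simp add: matrix_mul_assoc)
  then show ?thesis by (rule that[OF c refl])
qed

lemma root_subspace_nil_space:
  assumes "invertible Z" "Z = local_lead E A x + mat c ** local_coeff E A x"
    "Z ** T = local_coeff E A x"
  shows "root_subspace E A x = nil_space T"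
  unfolding root_subspace_def jordan_chain_iff by (rule chain_set_eq_nil_space[OF assms])

text \<open>With \<open>u = s - z\<close> the local pencil \<open>u E - (A - z E)\<close> is
  \<open>s E - A\<close>, so \<open>det_pencil_factor\<close> exhibits the order of the root
  \<open>z\<close>. The factorization is known only for \<open>s\<close> different from
  \<open>z\<close>, which suffices for polynomials.\<close>

lemma dim_root_subspace_Fin:
  assumes "regular_pencil E A"
  shows "vec.dim (root_subspace E A (Fin z)) = order z (pencil_det E A)"
proof -
  obtain c Z T where Z: "invertible Z" "Z = local_lead E A (Fin z) + mat c ** local_coeff E A (Fin z)"
    "Z ** T = local_coeff E A (Fin z)"
    using local_pencil_invertible[OF assms] .
  let ?d = "vec.dim (nil_space T)"
  obtain g where g: "poly g 0 \<noteq> 0" and gu: "\<And>u. u \<noteq> 0 \<Longrightarrow>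
    det (mat u ** local_lead E A (Fin z) - local_coeff E A (Fin z)) = u ^ ?d * poly g u"
    using det_pencil_factor[OF Z] by metis
  have "pencil_det E A = [:- z, 1:] ^ ?d * pcompose g [:- z, 1:]"
  proof (rule poly_eq_if_eq_off_point[of z])
    fix s assume "s \<noteq> z"
    then have "det (mat (s - z) ** local_lead E A (Fin z) - local_coeff E A (Fin z)) =
        (s - z) ^ ?d * poly g (s - z)" by (intro gu) simp
    moreover have "mat (s - z) ** local_lead E A (Fin z) - local_coeff E A (Fin z) = pencil_at E A (Fin s)"
      by (simp add: vec_eq_iff mat_mult_nth algebra_simps)
    ultimately show "poly (pencil_det E A) s = poly ([:- z, 1:] ^ ?d * pcompose g [:- z, 1:]) s"
      unfolding poly_pencil_det by (simp add: poly_power poly_pcompose)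
  qed
  moreover have "poly (pcompose g [:- z, 1:]) z \<noteq> 0" using g by (simp add: poly_pcompose)
  moreover from this have "pcompose g [:- z, 1:] \<noteq> 0" by force
  ultimately have "order z (pencil_det E A) = ?d"
    by (simp add: order_mult order_power_n_n order_0I)
  then show ?thesis using root_subspace_nil_space[OF Z] by simp
qed

text \<open>With \<open>u = 1/s\<close> the local pencil \<open>u A - E\<close> is
  \<open>-(1/s) (s E - A)\<close>. Clearing denominators gives
  \<open>(-1)^n s^(d + deg g) det (s E - A) = s^n r(s)\<close> with \<open>r\<close> the reversal of
  \<open>g\<close>, which has the degree of \<open>g\<close> as \<open>g(0)\<close> is nonzero; the
  claim compares degrees.\<close>

lemma dim_root_subspace_Infty:
  fixes E A :: "complex^'n^'n"
  assumes "regular_pencil E A"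
  shows "vec.dim (root_subspace E A Infty) + degree (pencil_det E A) = CARD('n)"
proof -
  obtain c Z T where Z: "invertible Z" "Z = local_lead E A Infty + mat c ** local_coeff E A Infty"
    "Z ** T = local_coeff E A Infty"
    using local_pencil_invertible[OF assms] .
  let ?d = "vec.dim (nil_space T)" and ?n = "CARD('n)"
  obtain g where g: "poly g 0 \<noteq> 0" and gu: "\<And>u. u \<noteq> 0 \<Longrightarrow>
    det (mat u ** local_lead E A Infty - local_coeff E A Infty) = u ^ ?d * poly g u"
    using det_pencil_factor[OF Z] by metis
  have g0: "g \<noteq> 0" using g by auto
  have "monom ((-1) ^ ?n) (?d + degree g) * pencil_det E A = monom 1 ?n * reflect_poly g"
  proof (rule poly_eq_if_eq_off_point[of 0])
    fix s :: complex assume s: "s \<noteq> 0"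
    have "mat (1 / s) ** local_lead E A Infty - local_coeff E A Infty = mat (- 1 / s) ** pencil_at E A (Fin s)"
      using s by (simp add: vec_eq_iff mat_mult_nth field_simps)
    then have e: "(- 1 / s) ^ ?n * poly (pencil_det E A) s = (1 / s) ^ ?d * poly g (1 / s)"
      using gu[of "1 / s"] s unfolding poly_pencil_det det_mat_mult[symmetric] by simp
    have a1: "s ^ ?n * (- 1 / s) ^ ?n = (- 1) ^ ?n"
      unfolding power_mult_distrib[symmetric] using s by simp
    have a2: "s ^ ?d * (1 / s) ^ ?d = 1"
      unfolding power_mult_distrib[symmetric] using s by simp
    have "(- 1) ^ ?n * s ^ ?d * poly (pencil_det E A) s =
        s ^ ?d * (s ^ ?n * ((- 1 / s) ^ ?n * poly (pencil_det E A) s))"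
      by (simp only: a1[symmetric] ac_simps)
    also have "\<dots> = s ^ ?n * (s ^ ?d * (1 / s) ^ ?d) * poly g (1 / s)"
      unfolding e by (simp only: ac_simps)
    also have "\<dots> = s ^ ?n * poly g (1 / s)" unfolding a2 by simp
    finally have "(- 1) ^ ?n * s ^ ?d * poly (pencil_det E A) s * s ^ degree g =
        s ^ ?n * poly g (1 / s) * s ^ degree g" by simp
    moreover have "poly (reflect_poly g) s = s ^ degree g * poly g (1 / s)"
      using poly_reflect_poly_nz[OF s, of g] by (simp add: inverse_eq_divide)
    ultimately show "poly (monom ((-1) ^ ?n) (?d + degree g) * pencil_det E A) s =
        poly (monom 1 ?n * reflect_poly g) s"
      unfolding poly_mult poly_monom power_add by (simp only: ac_simps) simp
  qed
  then have "degree (monom ((-1) ^ ?n :: complex) (?d + degree g) * pencil_det E A)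
     = degree (monom (1::complex) ?n * reflect_poly g)" by simp
  moreover have "pencil_det E A \<noteq> 0" using assms by (simp add: regular_pencil_iff)
  moreover have "degree (reflect_poly g) = degree g" "reflect_poly g \<noteq> 0"
    using g g0 by (simp_all add: poly_0_coeff_0)
  ultimately have "?d + degree g + degree (pencil_det E A) = ?n + degree g"
    by (simp add: degree_mult_eq degree_monom_eq)
  then show ?thesis using root_subspace_nil_space[OF Z] by simp
qed

lemma pencil_spectrum_iff:
  "x \<in> pencil_spectrum E A \<longleftrightarrow> vec.dim (root_subspace E A x) \<noteq> 0"
proof -
  have "root_subspace E A x \<subseteq> {0} \<longleftrightarrow> (\<forall>v. local_coeff E A x *v v = 0 \<longrightarrow> v = 0)"
  proof
    assume L: "root_subspace E A x \<subseteq> {0}"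
    show "\<forall>v. local_coeff E A x *v v = 0 \<longrightarrow> v = 0"
    proof (intro allI impI, rule ccontr)
      fix v assume v: "local_coeff E A x *v v = 0" "v \<noteq> 0"
      then have "jordan_chain E A x [v]" by (simp add: jordan_chain_iff chain_def)
      then have "v \<in> root_subspace E A x"
        unfolding root_subspace_def
        by (intro UnI2 UnionI[of "set [v]"] CollectI exI[of _ "[v]"] conjI refl) simp_all
      with L v(2) show False by blast
    qed
  next
    assume R: "\<forall>v. local_coeff E A x *v v = 0 \<longrightarrow> v = 0"
    then have "\<not> jordan_chain E A x gs" for gs by (simp add: jordan_chain_iff chain_def)
    then show "root_subspace E A x \<subseteq> {0}" by (simp add: root_subspace_def)
  qed
  then show ?thesis
    by (simp add: pencil_spectrum_def invertible_iff_kernel local_coeff_kernel)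
qed

lemma chain_lengths:
  assumes "regular_pencil E A" "x \<in> pencil_spectrum E A"
  shows "finite {length gs |gs. jordan_chain E A x gs}" "{length gs |gs. jordan_chain E A x gs} \<noteq> {}"
    "\<And>gs. jordan_chain E A x gs \<Longrightarrow> length gs \<le> vec.dim (root_subspace E A x)"
proof -
  obtain c Z T where Z: "invertible Z" "Z = local_lead E A x + mat c ** local_coeff E A x"
    "Z ** T = local_coeff E A x"
    using local_pencil_invertible[OF assms(1)] .
  show le: "length gs \<le> vec.dim (root_subspace E A x)" if "jordan_chain E A x gs" for gs
    using chain_length_le[OF Z, of gs] that root_subspace_nil_space[OF Z] by (simp add: jordan_chain_iff)
  then have "{length gs |gs. jordan_chain E A x gs} \<subseteq> {..vec.dim (root_subspace E A x)}" by auto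
  then show "finite {length gs |gs. jordan_chain E A x gs}" by (rule finite_subset) simp
  have "\<exists>v. pencil_at E A x *v v = 0 \<and> v \<noteq> 0"
    using assms(2) by (simp add: pencil_spectrum_def invertible_iff_kernel)
  then obtain v where "pencil_at E A x *v v = 0" "v \<noteq> 0" by blast
  then have "jordan_chain E A x [v]" by (simp add: jordan_chain_iff chain_def local_coeff_kernel)
  then show "{length gs |gs. jordan_chain E A x gs} \<noteq> {}" by blast
qed

lemma max_chain_length_le:
  assumes "regular_pencil E A" "x \<in> pencil_spectrum E A"
  shows "max_chain_length E A x \<le> vec.dim (root_subspace E A x)"
  unfolding max_chain_length_def
  using Max_in[OF chain_lengths(1,2)[OF assms]] chain_lengths(3)[OF assms] by auto

lemma max_chain_length_ge:
  assumes "regular_pencil E A" "x \<in> pencil_spectrum E A" "ker_dim (pencil_at E A x) \<le> 1"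
  shows "vec.dim (root_subspace E A x) \<le> max_chain_length E A x"
proof -
  obtain c Z T where Z: "invertible Z" "Z = local_lead E A x + mat c ** local_coeff E A x"
    "Z ** T = local_coeff E A x"
    using local_pencil_invertible[OF assms(1)] .
  have "nil_space T \<noteq> {0}"
  proof
    assume "nil_space T = {0}"
    then have "vec.dim (root_subspace E A x) = 0"
      unfolding vec.dim_eq_0 root_subspace_nil_space[OF Z] by simp
    then show False using assms(2) by (simp add: pencil_spectrum_iff del: vec.dim_eq_0)
  qed
  moreover have "vec.dim {v. local_coeff E A x *v v = 0} \<le> 1"
    using assms(3) by (simp add: ker_dim_def local_coeff_kernel)
  ultimately obtain gs where gs: "chain (local_coeff E A x) (local_lead E A x) gs"
    "vec.dim (nil_space T) \<le> length gs"
    using chain_length_ge[OF Z] by blast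
  then have "length gs \<in> {length gs |gs. jordan_chain E A x gs}" by (auto simp: jordan_chain_iff)
  then have "length gs \<le> max_chain_length E A x"
    unfolding max_chain_length_def by (rule Max_ge[OF chain_lengths(1)[OF assms(1,2)]])
  then show ?thesis using gs(2) root_subspace_nil_space[OF Z] by simp
qed

section \<open>Cramer polynomials and pole orders\<close>

lemma det_rank_one_fixed_row:
  fixes r :: "'n::finite \<Rightarrow> 'a::comm_ring_1^'n"
  assumes "finite S" "k \<notin> S"
  shows "det (\<chi> i. if i = k then b else if i \<in> S then r i - c i *s b else r i) =
    det (\<chi> i. if i = k then b else r i)"
  using assms
proof (induction S)
  case (insert x S)
  let ?M = "(\<chi> i. if i = k then b else if i \<in> S then r i - c i *s b else r i) :: 'a^'n^'n"
  have xk: "x \<noteq> k" using insert.prems by auto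
  have "(\<chi> i. if i = k then b else if i \<in> insert x S then r i - c i *s b else r i) =
      (\<chi> i. if i = x then row x ?M + (- c x) *s row k ?M else row i ?M)"
    using insert.hyps xk by (auto simp: vec_eq_iff row_def)
  then show ?case using det_row_operation[OF xk, of ?M "- c x"] insert by simp
qed (simp cong: if_cong)

text \<open>Multilinearity in the rows: \<open>b\<close> replaces at most one row, since once row
  \<open>k\<close> equals \<open>b\<close>, all other subtractions of multiples of \<open>b\<close>
  are row operations without effect.\<close>

lemma det_rank_one_rows:
  fixes r :: "'n::finite \<Rightarrow> 'a::comm_ring_1^'n"
  assumes "finite S"
  shows "det (\<chi> i. if i \<in> S then r i - c i *s b else r i) =
    det (\<chi> i. r i) - (\<Sum>k\<in>S. c k * det (\<chi> i. if i = k then b else r i))"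
  using assms
proof (induction S)
  case (insert x S)
  let ?R = "\<lambda>i. if i \<in> S then r i - c i *s b else r i"
  have "(\<chi> i. if i \<in> insert x S then r i - c i *s b else r i) =
      (\<chi> i. if i = x then r x + (- c x) *s b else ?R i)"
    using insert.hyps by (auto simp: vec_eq_iff)
  then have "det (\<chi> i. if i \<in> insert x S then r i - c i *s b else r i) =
      det (\<chi> i. if i = x then r x else ?R i) + (- c x) * det (\<chi> i. if i = x then b else ?R i)"
    using det_row_add[of x "\<lambda>i. r x" "\<lambda>i. (- c x) *s b" ?R] det_row_mul[of x "- c x" "\<lambda>i. b" ?R]
    by simp
  also have "(\<chi> i. if i = x then r x else ?R i) = (\<chi> i. ?R i)"
    using insert.hyps by (auto simp: vec_eq_iff)
  also have "det (\<chi> i. if i = x then b else ?R i) = det (\<chi> i. if i = x then b else r i)"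
    using det_rank_one_fixed_row[OF insert.hyps, of b r c] .
  finally show ?case using insert by (simp add: algebra_simps)
qed simp

text \<open>The matrix determinant lemma in a form without inverses, so that it also covers the
  points where the pencil is singular.\<close>

lemma det_minus_rank_one:
  fixes B :: "'a::comm_ring_1^'n^'n"
  shows "det (\<chi> i j. B $ i $ j - b $ i * c j) =
    det B - (\<Sum>k\<in>UNIV. c k * det (\<chi> i j. if j = k then b $ i else B $ i $ j))"
proof -
  have "det (\<chi> i j. B $ i $ j - b $ i * c j) = det (\<chi> i. column i B - c i *s b)"
    by (subst det_transpose[symmetric])
       (rule arg_cong[of _ _ det], simp add: vec_eq_iff transpose_def column_def mult.commute)
  also have "\<dots> = det (\<chi> i. column i B) - (\<Sum>k\<in>UNIV. c k * (\<lambda>k. det (\<chi> i. if i = k then b else column i B)) k)"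
    using det_rank_one_rows[of "UNIV :: 'n set" "\<lambda>i. column i B" c b] by simp
  also have "(\<chi> i. column i B) = transpose B"
    by (simp add: vec_eq_iff transpose_def column_def)
  also have "(\<lambda>k. det (\<chi> i. if i = k then b else column i B)) =
      (\<lambda>k. det (\<chi> i j. if j = k then b $ i else B $ i $ j))"
  proof
    fix k
    show "det (\<chi> i. if i = k then b else column i B) = det (\<chi> i j. if j = k then b $ i else B $ i $ j)"
      by (subst det_transpose[symmetric])
         (rule arg_cong[of _ _ det], simp add: vec_eq_iff transpose_def column_def)
  qed
  finally show ?thesis by simp
qed

definition cramer_poly :: "complex^'n^'n \<Rightarrow> complex^'n^'n \<Rightarrow> complex^'n \<Rightarrow> 'n \<Rightarrow> complex poly" where
  "cramer_poly E A b k = det (\<chi> i j. if j = k then [:b $ i:] else [:- (A $ i $ j), E $ i $ j:])"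

lemma poly_cramer_poly:
  "poly (cramer_poly E A b k) s = det (\<chi> i j. if j = k then b $ i else pencil_at E A (Fin s) $ i $ j)"
  unfolding cramer_poly_def poly_det by (rule arg_cong[of _ _ det]) (simp add: vec_eq_iff)

lemma pencil_det_feedback:
  "pencil_det E (A + outer b f) = pencil_det E A - (\<Sum>k\<in>UNIV. smult (cnj (f $ k)) (cramer_poly E A b k))"
proof -
  have "poly (pencil_det E (A + outer b f)) s =
    poly (pencil_det E A - (\<Sum>k\<in>UNIV. smult (cnj (f $ k)) (cramer_poly E A b k))) s" for s
  proof -
    have "pencil_at E (A + outer b f) (Fin s) =
        (\<chi> i j. pencil_at E A (Fin s) $ i $ j - b $ i * cnj (f $ j))"
      by (simp add: vec_eq_iff outer_def)
    then show ?thesis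
      unfolding poly_diff poly_sum poly_smult poly_cramer_poly poly_pencil_det
      by (simp only: det_minus_rank_one)
  qed
  then show ?thesis by (rule poly_eq_ext)
qed

lemma matrix_inv_mult:
  assumes "invertible (B :: 'a::semiring_1^'n^'m)"
  shows "B ** matrix_inv B = mat 1" "matrix_inv B ** B = mat 1"
  using someI_ex[OF assms[unfolded invertible_def]] by (simp_all add: matrix_inv_def)

lemma matrix_inv_cramer:
  assumes "poly (pencil_det E A) s \<noteq> 0"
  shows "(matrix_inv (pencil_at E A (Fin s)) *v b) $ k = poly (cramer_poly E A b k) s / poly (pencil_det E A) s"
proof -
  let ?B = "pencil_at E A (Fin s)"
  have d: "det ?B \<noteq> 0" using assms by (simp only: poly_pencil_det not_False_eq_True)
  then have "?B ** matrix_inv ?B = mat 1" by (simp only: invertible_det_nz[symmetric] matrix_inv_mult)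
  then have "?B *v (matrix_inv ?B *v b) = b" by (simp only: matrix_vector_mul_assoc matrix_vector_mul_lid)
  then have "matrix_inv ?B *v b = (\<chi> k. det (\<chi> i j. if j = k then b $ i else ?B $ i $ j) / det ?B)"
    by (simp only: cramer[OF d])
  then show ?thesis unfolding poly_cramer_poly poly_pencil_det by (simp only: vec_lambda_beta)
qed

lemma mult_vec_nth: "(B *v v) $ i = (\<Sum>j\<in>UNIV. B $ i $ j * v $ j)"
  by (simp add: matrix_vector_mult_def)

text \<open>Cramer's rule as the polynomial identity
  \<open>(s E - A) c(s) = det (s E - A) b\<close>, checked where the inverse exists.\<close>

lemma pencil_mult_cramer:
  assumes "regular_pencil E A"
  shows "(\<Sum>j\<in>UNIV. [:- (A $ i $ j), E $ i $ j:] * cramer_poly E A b j) = smult (b $ i) (pencil_det E A)"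
proof (rule poly_eqI_off_roots)
  show "pencil_det E A \<noteq> 0" using assms by (simp add: regular_pencil_iff)
  fix s assume s: "poly (pencil_det E A) s \<noteq> 0"
  let ?B = "pencil_at E A (Fin s)"
  have d: "det ?B \<noteq> 0" using s by (simp only: poly_pencil_det not_False_eq_True)
  then have "?B ** matrix_inv ?B = mat 1" by (simp only: invertible_det_nz[symmetric] matrix_inv_mult)
  then have "?B *v (matrix_inv ?B *v b) = b" by (simp only: matrix_vector_mul_assoc matrix_vector_mul_lid)
  then have "(\<Sum>j\<in>UNIV. ?B $ i $ j * (matrix_inv ?B *v b) $ j) = b $ i"
    by (simp only: mult_vec_nth[symmetric])
  then have "(\<Sum>j\<in>UNIV. ?B $ i $ j * (poly (cramer_poly E A b j) s / poly (pencil_det E A) s)) = b $ i"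
    by (simp only: matrix_inv_cramer[OF s])
  then have "(\<Sum>j\<in>UNIV. ?B $ i $ j * poly (cramer_poly E A b j) s) = b $ i * poly (pencil_det E A) s"
    using s by (simp add: sum_divide_distrib[symmetric] field_simps)
  then show "poly (\<Sum>j\<in>UNIV. [:- (A $ i $ j), E $ i $ j:] * cramer_poly E A b j) s =
      poly (smult (b $ i) (pencil_det E A)) s"
    by (simp add: poly_sum algebra_simps)
qed

lemma degree_det_le:
  fixes M :: "'a::idom poly^'n^'n"
  assumes "\<And>i j. degree (M $ i $ j) \<le> d j"
  shows "degree (det M) \<le> (\<Sum>j\<in>UNIV. d j)"
  unfolding det_def
proof (rule degree_sum_le)
  show "finite {p. p permutes (UNIV :: 'n set)}" by simp
  fix p assume "p \<in> {p. p permutes (UNIV :: 'n set)}"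
  then have p: "p permutes UNIV" by simp
  have "degree (\<Prod>i\<in>UNIV. M $ i $ p i) \<le> (\<Sum>i\<in>UNIV. degree (M $ i $ p i))"
    using degree_prod_sum_le[of UNIV "\<lambda>i. M $ i $ p i"] by (simp add: comp_def)
  also have "\<dots> \<le> (\<Sum>i\<in>UNIV. d (p i))" by (rule sum_mono) (rule assms)
  also have "\<dots> = (\<Sum>i\<in>UNIV. d i)" using sum.permute[OF p, of d] by (simp add: comp_def)
  finally have "degree (\<Prod>i\<in>UNIV. M $ i $ p i) \<le> (\<Sum>i\<in>UNIV. d i)" .
  then show "degree (of_int (sign p) * (\<Prod>i\<in>UNIV. M $ i $ p i)) \<le> (\<Sum>i\<in>UNIV. d i)"
    by (cases "evenperm p") (simp_all add: sign_def)
qed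

text \<open>Column \<open>k\<close> is constant and the others are affine. The strictness of the
  bound is what makes \<open>m0_Infty_less\<close> strict.\<close>

lemma degree_cramer_poly: "degree (cramer_poly E A (b :: complex^'n) k) < CARD('n)"
proof -
  have "degree (cramer_poly E A b k) \<le> (\<Sum>j\<in>UNIV. if j = k then 0 else 1)"
    unfolding cramer_poly_def by (rule degree_det_le) simp
  also have "\<dots> = card (UNIV - {k})"
    by (simp add: sum.If_cases Compl_eq_Diff_UNIV)
  also have "\<dots> < CARD('n)" by (rule card_Diff1_less) simp_all
  finally show ?thesis .
qed

text \<open>A kernel of dimension at least two contains a nonzero vector with vanishing entry
  \<open>k\<close>. It does not see column \<open>k\<close>, so it stays in the kernel after that
  column is replaced by \<open>b\<close>.\<close>

lemma cramer_poly_root_if_ker_dim: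
  fixes E A :: "complex^'n^'n"
  assumes "ker_dim (pencil_at E A (Fin z)) \<ge> 2"
  shows "poly (cramer_poly E A b k) z = 0"
proof -
  let ?B = "pencil_at E A (Fin z)"
  let ?K = "{v. ?B *v v = 0}"
  define R where "R = (\<chi> i j. if i = k \<and> j = k then 1 else (0::complex))"
  have R: "R *v v = axis k (v $ k)" for v
    by (auto simp: R_def vec_eq_iff matrix_vector_mult_def axis_def if_distrib[of "\<lambda>x. x * _"] cong: if_cong)
  have sub: "vec.subspace ?K" by (auto simp: vec.subspace_def vec.add vec.scale)
  have "vec.dim ((*v) R ` ?K) \<le> card {axis k (1::complex)}"
  proof (rule vec.dim_le_card)
    show "(*v) R ` ?K \<subseteq> vec.span {axis k 1}"
    proof
      fix w assume "w \<in> (*v) R ` ?K"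
      then obtain v where "w = R *v v" by blast
      also have "R *v v = (v $ k) *s axis k 1" unfolding R by (simp add: vec_eq_iff axis_def)
      finally show "w \<in> vec.span {axis k 1}" by (simp add: vec.span_base vec.span_scale)
    qed
  qed simp
  moreover have "vec.dim ((*v) R ` ?K) + vec.dim {v \<in> ?K. R *v v = 0} = vec.dim ?K"
    by (rule dim_image_plus_kernel[OF matrix_vector_mul_linear_gen sub])
  moreover have "card {axis k (1::complex)} = 1" by (rule is_singletonI[THEN is_singleton_altdef[THEN iffD1]])
  ultimately have "vec.dim {v \<in> ?K. R *v v = 0} \<noteq> 0"
    using assms unfolding ker_dim_def by linarith
  then obtain v where v: "?B *v v = 0" "R *v v = 0" "v \<noteq> 0" unfolding vec.dim_eq_0 by blast
  have vk: "v $ k = 0" using v(2) unfolding R by (simp add: vec_eq_iff axis_def split: if_splits)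
  let ?C = "(\<chi> i j. if j = k then b $ i else ?B $ i $ j) :: complex^'n^'n"
  have "?C *v v = ?B *v v"
    unfolding vec_eq_iff mult_vec_nth by (intro allI sum.cong) (auto simp: vk)
  then have Cv: "?C *v v = 0" unfolding v(1) .
  have "\<not> invertible ?C"
  proof
    assume "invertible ?C"
    from this[unfolded invertible_iff_kernel, rule_format, OF Cv] v(3) show False by contradiction
  qed
  then show ?thesis unfolding poly_cramer_poly invertible_det_nz by simp
qed

section \<open>Pole orders of rational functions\<close>

lemma not_is_pole_isCont:
  fixes g :: "complex \<Rightarrow> complex"
  assumes "isCont g z" "eventually (\<lambda>s. h s = g s) (at z)"
  shows "\<not> is_pole h z"
proof
  assume "is_pole h z"
  then have "is_pole g z" using is_pole_cong[OF assms(2) refl] by simp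
  moreover have "(g \<longlongrightarrow> g z) (at z)" using assms(1) by (simp add: isCont_def)
  ultimately show False
    unfolding is_pole_def using not_tendsto_and_filterlim_at_infinity[of "at z" g "g z"] by simp
qed

lemma order_factor:
  fixes P :: "'a::idom poly"
  assumes "P \<noteq> 0"
  obtains P' where "P = [:- z, 1:] ^ order z P * P'" "poly P' z \<noteq> 0"
proof -
  obtain P' where P': "P = [:- z, 1:] ^ order z P * P'" "\<not> [:- z, 1:] dvd P'"
    using order_decomp[OF assms, of z] by blast
  then show ?thesis using that by (simp add: poly_eq_0_iff_dvd)
qed

text \<open>Truncated subtraction yields 0 when the numerator cancels the denominator at
  \<open>z\<close>. The case \<open>P = 0\<close> is separate because \<open>order\<close> is
  meaningless for the zero polynomial.\<close>

lemma pole_order_rational: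
  fixes P Q :: "complex poly"
  assumes ev: "eventually (\<lambda>s. h s = poly P s / poly Q s) (at z)" and Q: "Q \<noteq> 0"
  shows "pole_order h z = (if P = 0 then 0 else order z Q - order z P)"
proof (cases "P = 0")
  case True
  then have "\<not> is_pole h z" using ev by (intro not_is_pole_isCont[where g = "\<lambda>_. 0"]) simp_all
  then show ?thesis using True by (simp add: pole_order_def)
next
  case False
  obtain P' where P': "P = [:- z, 1:] ^ order z P * P'" "poly P' z \<noteq> 0"
    using order_factor[OF False] .
  obtain Q' where Q': "Q = [:- z, 1:] ^ order z Q * Q'" "poly Q' z \<noteq> 0"
    using order_factor[OF Q] .
  let ?a = "order z P" and ?d = "order z Q"
  have Pe: "poly P s = (s - z) ^ ?a * poly P' s" for s
    by (subst P'(1)) (simp add: poly_power)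
  have Qe: "poly Q s = (s - z) ^ ?d * poly Q' s" for s
    by (subst Q'(1)) (simp add: poly_power)
  show ?thesis
  proof (cases "?d \<le> ?a")
    case True
    have "eventually (\<lambda>s. h s = (s - z) ^ (?a - ?d) * poly P' s / poly Q' s) (at z)"
      using ev eventually_neq_at_within[of z z UNIV]
    proof eventually_elim
      case (elim s)
      have "(s - z) ^ ?a = (s - z) ^ ?d * (s - z) ^ (?a - ?d)"
        using True by (simp add: power_add[symmetric])
      then show ?case using elim unfolding Pe Qe by simp
    qed
    then have "\<not> is_pole h z"
      by (rule not_is_pole_isCont[rotated]) (use Q'(2) in \<open>intro continuous_intros\<close>)
    then show ?thesis using True by (simp add: pole_order_def)
  next
    case d: False
    have ev2: "eventually (\<lambda>s. h s = (poly P' s / poly Q' s) / (s - z) ^ (?d - ?a)) (at z)"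
      using ev eventually_neq_at_within[of z z UNIV]
    proof eventually_elim
      case (elim s)
      have "(s - z) ^ ?d = (s - z) ^ ?a * (s - z) ^ (?d - ?a)"
        using d by (simp add: power_add[symmetric])
      then show ?case using elim unfolding Pe Qe by simp
    qed
    have "is_pole (\<lambda>s. (poly P' s / poly Q' s) / (s - z) ^ (?d - ?a)) z"
    proof (rule is_pole_divide)
      show "isCont (\<lambda>s. poly P' s / poly Q' s) z" using Q'(2) by (intro continuous_intros)
      have "isCont (\<lambda>s. (s - z) ^ (?d - ?a)) z" by (intro continuous_intros)
      then have "((\<lambda>s. (s - z) ^ (?d - ?a)) \<longlongrightarrow> 0) (at z)" using d by (simp add: isCont_def power_0_left)
      moreover have "eventually (\<lambda>s. (s - z) ^ (?d - ?a) \<noteq> 0) (at z)"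
        using eventually_neq_at_within[of z z UNIV] by eventually_elim simp
      ultimately show "filterlim (\<lambda>s. (s - z) ^ (?d - ?a)) (at 0) (at z)"
        by (simp add: filterlim_at)
      show "poly P' z / poly Q' z \<noteq> 0" using P' Q' by simp
    qed
    then have pole: "is_pole h z" using is_pole_cong[OF ev2 refl] by simp
    obtain S where S: "open S" "z \<in> S"
      "\<And>s. s \<in> S \<Longrightarrow> s \<noteq> z \<Longrightarrow> h s = (poly P' s / poly Q' s) / (s - z) ^ (?d - ?a)"
      using ev2 unfolding eventually_at_topological by blast
    have "zorder h z = - int (?d - ?a)"
    proof (rule zorder_eqI)
      have "open {s. poly Q' s \<noteq> 0}" by (intro open_Collect_neq continuous_intros)
      then show "open (S \<inter> {s. poly Q' s \<noteq> 0})" using S(1) by (rule open_Int[rotated])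
      show "z \<in> S \<inter> {s. poly Q' s \<noteq> 0}" using S(2) Q'(2) by simp
      show "(\<lambda>s. poly P' s / poly Q' s) holomorphic_on S \<inter> {s. poly Q' s \<noteq> 0}"
        by (intro holomorphic_intros) simp
      show "poly P' z / poly Q' z \<noteq> 0" using P' Q' by simp
      fix w assume "w \<in> S \<inter> {s. poly Q' s \<noteq> 0}" "w \<noteq> z"
      then have "h w = (poly P' w / poly Q' w) / (w - z) ^ (?d - ?a)" using S(3) by blast
      then show "h w = poly P' w / poly Q' w * (w - z) powi - int (?d - ?a)"
        by (simp add: power_int_minus divide_inverse)
    qed
    then show ?thesis using pole False by (simp add: pole_order_def)
  qed
qed

lemma eventually_poly_nonzero:
  fixes P :: "complex poly"
  assumes "P \<noteq> 0"
  shows "eventually (\<lambda>s. poly P s \<noteq> 0) (at z)"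
proof -
  have "finite ({s. poly P s = 0} - {z})" using poly_roots_finite[OF assms] by simp
  then have "open (- ({s. poly P s = 0} - {z}))" by (intro open_Compl finite_imp_closed)
  then show ?thesis unfolding eventually_at_topological
    by (intro exI[of _ "- ({s. poly P s = 0} - {z})"]) auto
qed

lemma matrix_vector_mult_neg: "B *v (- v) = - (B *v v)" for B :: "complex^'n^'n"
  using vec.neg[of B v] by simp

lemma order_monom_reflect:
  "P \<noteq> 0 \<Longrightarrow> order 0 (monom 1 k * reflect_poly (P :: complex poly)) = k"
proof -
  assume "P \<noteq> 0"
  have "poly (reflect_poly P) 0 \<noteq> 0" using \<open>P \<noteq> 0\<close> by simp
  moreover from this have "order 0 (reflect_poly P) = 0" by (rule order_0I)
  moreover have "order 0 (monom (1::complex) k) = k"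
    using order_power_n_n[of "0::complex" k] by (simp add: monom_altdef)
  ultimately show ?thesis using \<open>P \<noteq> 0\<close> by (simp add: order_mult monom_eq_0_iff)
qed

text \<open>\<open>p / q\<close> is the reduced form of the rational vector function \<open>s \<mapsto> (s E - A)\<^sup>-\<^sup>1 b\<close>,
  and \<open>h\<close> collects the uncontrollable eigenvalues.\<close>

locale reduced_pencil =
  fixes E A :: "complex^'n^'n" and b :: "complex^'n"
    and h q :: "complex poly" and p :: "'n \<Rightarrow> complex poly"
  assumes regular: "regular_pencil E A"
    and det_eq: "pencil_det E A = h * q"
    and cramer_eq: "\<And>i. cramer_poly E A b i = h * p i"
    and monic: "lead_coeff q = 1"
    and no_common_root: "\<And>z. poly q z = 0 \<Longrightarrow> \<exists>i. poly (p i) z \<noteq> 0"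
begin

lemma nonzero: "h \<noteq> 0" "q \<noteq> 0" "pencil_det E A \<noteq> 0"
  using regular unfolding regular_pencil_iff det_eq by auto

lemma resolvent_eq:
  assumes "poly (pencil_det E A) s \<noteq> 0"
  shows "(matrix_inv (pencil_at E A (Fin s)) *v b) $ i = poly (p i) s / poly q s"
  using matrix_inv_cramer[OF assms, of b i] assms by (simp add: cramer_eq det_eq)

lemma pole_order_Fin:
  "pole_order (\<lambda>s. (matrix_inv (pencil_at E A (Fin s)) *v (- b)) $ i) z =
    (if p i = 0 then 0 else order z q - order z (p i))"
proof -
  have "eventually (\<lambda>s. (matrix_inv (pencil_at E A (Fin s)) *v (- b)) $ i = poly (- p i) s / poly q s) (at z)"
    using eventually_poly_nonzero[OF nonzero(3), of z]
    by eventually_elim (simp add: matrix_vector_mult_neg resolvent_eq del: pencil_at.simps)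
  from pole_order_rational[OF this nonzero(2)] show ?thesis by simp
qed

text \<open>At least one entry shows no cancellation: at a root of \<open>q\<close> some
  \<open>p i\<close> does not vanish.\<close>

lemma m0_Fin: "m0 E A (- b) (Fin z) = order z q"
proof -
  let ?f = "\<lambda>i. if p i = 0 then 0 else order z q - order z (p i)"
  have "m0 E A (- b) (Fin z) = Max (range ?f)"
    by (simp only: m0.simps vec_pole_order_def pole_order_Fin)
  also have "\<dots> = order z q"
  proof (rule Max_eqI)
    show "finite (range ?f)" by simp
    show "y \<le> order z q" if "y \<in> range ?f" for y using that by (auto split: if_splits)
    show "order z q \<in> range ?f"
    proof (cases "poly q z = 0")
      case True
      then obtain i where i: "poly (p i) z \<noteq> 0" using no_common_root by blast
      then have "p i \<noteq> 0" by auto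
      then have "order z q = ?f i" using i by (simp add: order_0I)
      then show ?thesis by (rule range_eqI)
    next
      case False
      then show ?thesis by (auto simp: order_0I)
    qed
  qed
  finally show ?thesis .
qed

lemma rev_resolvent_eq:
  assumes s: "s \<noteq> 0" "poly (pencil_det E A) (1 / s) \<noteq> 0"
  shows "(matrix_inv (rev_pencil_at E A s) *v v) = (1 / s) *s (matrix_inv (pencil_at E A (Fin (1 / s))) *v v)"
proof -
  let ?B = "pencil_at E A (Fin (1 / s))" and ?R = "rev_pencil_at E A s"
  have RB: "?R = mat s ** ?B"
    using s(1) by (simp add: rev_pencil_at_def vec_eq_iff mat_mult_nth field_simps)
  have dB: "det ?B \<noteq> 0" using s(2) by (simp only: poly_pencil_det not_False_eq_True)
  have dR: "det ?R \<noteq> 0" unfolding RB det_mat_mult using dB s(1) by simp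
  have R: "matrix_inv ?R ** ?R = mat 1"
    by (rule matrix_inv_mult) (use dR in \<open>simp only: invertible_det_nz not_False_eq_True\<close>)
  have B: "?B ** matrix_inv ?B = mat 1"
    by (rule matrix_inv_mult) (use dB in \<open>simp only: invertible_det_nz not_False_eq_True\<close>)
  have "?R *v ((1 / s) *s (matrix_inv ?B *v v)) = (s * (1 / s)) *s (?B *v (matrix_inv ?B *v v))"
    unfolding RB by (simp only: matrix_vector_mul_assoc[symmetric] mat_mult_vec vec.scale vec.scale_scale mult.commute)
  also have "\<dots> = v" using s(1) by (simp only: matrix_vector_mul_assoc B matrix_vector_mul_lid) simp
  finally have *: "?R *v ((1 / s) *s (matrix_inv ?B *v v)) = v" .
  have "matrix_inv ?R *v v = matrix_inv ?R *v (?R *v ((1 / s) *s (matrix_inv ?B *v v)))" by (simp only: *)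
  also have "\<dots> = (1 / s) *s (matrix_inv ?B *v v)"
    by (simp only: matrix_vector_mul_assoc R matrix_vector_mul_lid)
  finally show ?thesis .
qed

lemma eventually_inverse_nonroot: "eventually (\<lambda>s. s \<noteq> 0 \<and> poly (pencil_det E A) (1 / s) \<noteq> 0) (at 0)"
proof -
  have "reflect_poly (pencil_det E A) \<noteq> 0" using nonzero(3) by simp
  then have "eventually (\<lambda>s. poly (reflect_poly (pencil_det E A)) s \<noteq> 0) (at 0)"
    by (rule eventually_poly_nonzero)
  then show ?thesis using eventually_neq_at_within[of 0 0 UNIV]
    by eventually_elim (simp add: poly_reflect_poly_nz inverse_eq_divide)
qed

text \<open>The choices \<open>j = 1\<close>, \<open>k = 0\<close>, \<open>c = - 1\<close> and
  \<open>j = 0\<close>, \<open>k = 1\<close>, \<open>c = 1\<close> are the functions in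
  \<open>m0\<close> at infinity and in \<open>acts_at_infinity\<close>; the latter has one more
  factor \<open>1/s\<close>.\<close>

lemma pole_order_Infty:
  assumes "k + j = 1"
  shows "pole_order (\<lambda>s. (matrix_inv (rev_pencil_at E A s) *v (c *s ((s ^ j) *s b))) $ i) 0 =
    (if c = 0 \<or> p i = 0 then 0 else degree (p i) + k - degree q)"
proof -
  \<comment> \<open>Substituting \<open>1/s\<close> into \<open>p i\<close> and \<open>q\<close>
    gives reversed polynomials divided by powers of \<open>s\<close>; a nonzero reversed polynomial
    has nonzero constant term, so the orders at 0 are those of the monomials.\<close>
  let ?P = "smult c (monom 1 (degree q) * reflect_poly (p i))"
  let ?Q = "monom 1 (degree (p i) + k) * reflect_poly q"
  have ev: "eventually (\<lambda>s. (matrix_inv (rev_pencil_at E A s) *v (c *s ((s ^ j) *s b))) $ i = poly ?P s / poly ?Q s) (at 0)"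
    using eventually_inverse_nonroot
  proof eventually_elim
    case (elim s)
    then have s: "s \<noteq> 0" "poly (pencil_det E A) (1 / s) \<noteq> 0" by blast+
    have sj: "(1 / s) * s ^ j = 1 / s ^ k" using assms s(1) by (cases k) (auto simp: field_simps)
    have "(matrix_inv (rev_pencil_at E A s) *v (c *s ((s ^ j) *s b))) $ i =
        c * ((1 / s) * s ^ j) * (matrix_inv (pencil_at E A (Fin (1 / s))) *v b) $ i"
      unfolding rev_resolvent_eq[OF s] vec.scale vector_smult_component by (simp only: ac_simps)
    also have "\<dots> = c * (1 / s ^ k) * (poly (p i) (1 / s) / poly q (1 / s))"
      unfolding resolvent_eq[OF s(2)] sj ..
    also have "\<dots> = poly ?P s / poly ?Q s"
      using s(1) by (simp add: poly_monom poly_reflect_poly_nz inverse_eq_divide power_add)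
    finally show ?case .
  qed
  have "?Q \<noteq> 0" using nonzero(2) by (simp add: monom_eq_0_iff)
  from pole_order_rational[OF ev this]
  have "pole_order (\<lambda>s. (matrix_inv (rev_pencil_at E A s) *v (c *s ((s ^ j) *s b))) $ i) 0 =
    (if ?P = 0 then 0 else order 0 ?Q - order 0 ?P)" .
  also have "\<dots> = (if c = 0 \<or> p i = 0 then 0 else degree (p i) + k - degree q)"
    using order_monom_reflect[OF nonzero(2), of "degree (p i) + k"] order_monom_reflect[of "p i" "degree q"]
    by (auto simp: order_smult monom_eq_0_iff)
  finally show ?thesis .
qed

text \<open>The degree of the vector polynomial \<open>p\<close>; it is 0 also when all entries
  vanish, as happens for \<open>b = 0\<close>.\<close>

definition max_degree :: nat where "max_degree = Max (range (\<lambda>i. degree (p i)))"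

lemma degree_le_max_degree: "degree (p i) \<le> max_degree"
  unfolding max_degree_def by (rule Max_ge) simp_all

lemma max_degree_attained: "\<exists>i. degree (p i) = max_degree"
proof -
  have "max_degree \<in> range (\<lambda>i. degree (p i))" unfolding max_degree_def by (rule Max_in) simp_all
  then show ?thesis by (auto simp: image_def)
qed

lemma m0_Infty: "m0 E A (- b) Infty = max_degree - degree q"
proof -
  let ?f = "\<lambda>i. if p i = 0 then 0 else degree (p i) - degree q"
  have "pole_order (\<lambda>s. (matrix_inv (rev_pencil_at E A s) *v (s *s (- b))) $ i) 0 = ?f i" for i
    using pole_order_Infty[of 0 1 "- 1" i] by simp
  then have "m0 E A (- b) Infty = Max (range ?f)" by (simp only: m0.simps vec_pole_order_def)
  also have "\<dots> = max_degree - degree q"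
  proof (rule Max_eqI)
    show "finite (range ?f)" by simp
    show "y \<le> max_degree - degree q" if "y \<in> range ?f" for y
      using that by (auto split: if_splits intro: diff_le_mono degree_le_max_degree)
    obtain i where "degree (p i) = max_degree" using max_degree_attained by blast
    then have "max_degree - degree q = ?f i" by auto
    then show "max_degree - degree q \<in> range ?f" by (rule range_eqI)
  qed
  finally show ?thesis .
qed

text \<open>A pole means \<open>degree (p i) + 1 > degree q\<close> for some \<open>i\<close>. This
  rules out \<open>max_degree < degree q\<close>, which \<open>m0\<close> at infinity does not tell
  apart from \<open>max_degree = degree q\<close>, being 0 in both cases.\<close>

lemma acts_at_infinity_degree: "acts_at_infinity E A b \<Longrightarrow> degree q \<le> max_degree"
proof -
  let ?f = "\<lambda>i. if p i = 0 then 0 else degree (p i) + 1 - degree q"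
  assume "acts_at_infinity E A b"
  moreover have "pole_order (\<lambda>s. (matrix_inv (rev_pencil_at E A s) *v b) $ i) 0 = ?f i" for i
    using pole_order_Infty[of 1 0 1 i] by simp
  ultimately have "0 < Max (range ?f)"
    unfolding acts_at_infinity_def vec_pole_order_def by (simp only:)
  moreover have "Max (range ?f) \<in> range ?f"
    by (rule Max_in) (simp_all only: finite_imageI finite_class.finite_UNIV image_is_empty UNIV_not_empty not_False_eq_True)
  then obtain i where "Max (range ?f) = ?f i" by (rule rangeE)
  ultimately have "0 < ?f i" by (simp only:)
  then have "degree q \<le> degree (p i)" by (simp split: if_splits)
  then show ?thesis using degree_le_max_degree[of i] by linarith
qed

text \<open>Each finite point contributes the order of \<open>q\<close>, and over the complex
  numbers these orders add up to the degree.\<close>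

lemma M0_eq: "M0 E A (- b) = degree q + (if invertible E then 0 else max_degree - degree q)"
proof -
  let ?S = "{z. poly (pencil_det E A) z = 0}"
  have finS: "finite ?S" using nonzero(3) by (rule poly_roots_finite)
  have FinS: "Fin z \<in> pencil_spectrum E A \<longleftrightarrow> z \<in> ?S" for z
    by (simp only: pencil_spectrum_def mem_Collect_eq poly_pencil_det invertible_det_nz not_not)
  have InfS: "Infty \<in> pencil_spectrum E A \<longleftrightarrow> \<not> invertible E"
    by (simp add: pencil_spectrum_def)
  have Seq: "pencil_spectrum E A = Fin ` ?S \<union> (if invertible E then {} else {Infty})"
  proof (rule set_eqI)
    fix x show "x \<in> pencil_spectrum E A \<longleftrightarrow> x \<in> Fin ` ?S \<union> (if invertible E then {} else {Infty})"
      using FinS InfS by (cases x) (auto simp del: pencil_at.simps)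
  qed
  have "(\<Sum>x\<in>Fin ` ?S. m0 E A (- b) x) = (\<Sum>z\<in>?S. order z q)"
    by (subst sum.reindex) (auto simp: inj_on_def m0_Fin simp del: m0.simps)
  also have "\<dots> = (\<Sum>z | poly q z = 0. order z q)"
    by (rule sum.mono_neutral_right) (use finS in \<open>auto simp: det_eq order_0I\<close>)
  also have "\<dots> = degree q"
  proof -
    have "degree q = degree (smult (lead_coeff q) (\<Prod>z | poly q z = 0. [:- z, 1:] ^ order z q))"
      by (simp only: complex_poly_decompose)
    also have "\<dots> = (\<Sum>z | poly q z = 0. order z q)"
      unfolding monic by (simp add: degree_prod_sum_eq degree_power_eq)
    finally show ?thesis ..
  qed
  finally have "(\<Sum>x\<in>Fin ` ?S. m0 E A (- b) x) = degree q" .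
  moreover have "Infty \<notin> Fin ` ?S" by auto
  ultimately show ?thesis
    unfolding M0_def Seq using finS by (auto simp: m0_Infty simp del: m0.simps)
qed

end

section \<open>Polynomials attained by feedback\<close>

text \<open>The witness is a point of the moment curve.\<close>

lemma exists_nonvanishing_combination:
  fixes F :: "('n::finite \<Rightarrow> complex) set"
  assumes "finite F" "\<And>a. a \<in> F \<Longrightarrow> \<exists>i. a i \<noteq> 0"
  obtains c :: "'n \<Rightarrow> complex" where "\<And>a. a \<in> F \<Longrightarrow> (\<Sum>i\<in>UNIV. c i * a i) \<noteq> 0"
proof -
  obtain e :: "'n \<Rightarrow> nat" where e: "inj e"
    using finite_imp_inj_to_nat_seg[of "UNIV :: 'n set"] by auto
  \<comment> \<open>Distinct exponents make the pairing of \<open>a\<close> with the curve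
    \<open>x ^ e i\<close> a nonzero polynomial in \<open>x\<close>; finitely many such polynomials
    have a common non-root.\<close>
  define P where "P a = (\<Sum>i\<in>UNIV. monom (a i) (e i))" for a :: "'n \<Rightarrow> complex"
  have "P a \<noteq> 0" if a: "a \<in> F" for a
  proof -
    obtain i where i: "a i \<noteq> 0" using assms(2)[OF a] by blast
    have "coeff (P a) (e i) = (\<Sum>j\<in>UNIV. if j = i then a j else 0)"
      unfolding P_def coeff_sum coeff_monom by (rule sum.cong) (use e in \<open>auto simp: inj_def\<close>)
    then have "coeff (P a) (e i) \<noteq> 0" using i by simp
    then show ?thesis by auto
  qed
  then have "(\<Prod>a\<in>F. P a) \<noteq> 0" using assms(1) by simp
  then have "finite {x. poly (\<Prod>a\<in>F. P a) x = 0}" by (rule poly_roots_finite)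
  then obtain x where "poly (\<Prod>a\<in>F. P a) x \<noteq> 0"
    using ex_new_if_finite[OF infinite_UNIV_char_0] by blast
  then have x: "poly (P a) x \<noteq> 0" if "a \<in> F" for a
    using that assms(1) by (simp add: poly_prod)
  show ?thesis
  proof (rule that[of "\<lambda>i. x ^ e i"])
    fix a assume "a \<in> F"
    from x[OF this] show "(\<Sum>i\<in>UNIV. x ^ e i * a i) \<noteq> 0"
      by (simp add: P_def poly_sum poly_monom mult.commute)
  qed
qed

lemma smult_sum_right: "smult a (\<Sum>i\<in>S. f i) = (\<Sum>i\<in>S. smult a (f i))"
  by (induction S rule: infinite_finite_induct) (simp_all add: smult_add_right)

context reduced_pencil
begin

text \<open>The polynomial \<open>f* p\<close> as a function of the conjugated entries of
  \<open>f\<close>.\<close>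

definition combination :: "('n \<Rightarrow> complex) \<Rightarrow> complex poly" where
  "combination c = (\<Sum>i\<in>UNIV. smult (c i) (p i))"

lemma combination_add: "combination c + combination d = combination (\<lambda>i. c i + d i)"
  by (simp add: combination_def sum.distrib smult_add_left)

lemma combination_smult: "smult a (combination c) = combination (\<lambda>i. a * c i)"
  unfolding combination_def smult_sum_right by simp

lemma pencil_mult_p: "(\<Sum>j\<in>UNIV. [:- (A $ i $ j), E $ i $ j:] * p j) = smult (b $ i) q"
proof -
  have "h * (\<Sum>j\<in>UNIV. [:- (A $ i $ j), E $ i $ j:] * p j) = h * smult (b $ i) q"
    using pencil_mult_cramer[OF regular, of i b]
    unfolding cramer_eq det_eq sum_distrib_left by (simp add: mult.left_commute)
  then show ?thesis using nonzero(1) unfolding mult_cancel_left by blast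
qed

lemma pencil_at_mult_p: "pencil_at E A (Fin s) *v (\<chi> j. poly (p j) s) = poly q s *s b"
proof -
  have "poly (\<Sum>j\<in>UNIV. [:- (A $ i $ j), E $ i $ j:] * p j) s = poly (smult (b $ i) q) s" for i
    unfolding pencil_mult_p ..
  then show ?thesis
    by (simp add: vec_eq_iff mult_vec_nth poly_sum algebra_simps)
qed

text \<open>Where \<open>q\<close> does not vanish, \<open>(s E - A) p(s) = q(s) b\<close> is
  nonzero; the roots of \<open>q\<close> are covered by reducedness.\<close>

lemma p_no_common_root:
  assumes "b \<noteq> 0"
  shows "\<exists>i. poly (p i) z \<noteq> 0"
proof (cases "poly q z = 0")
  case False
  show ?thesis
  proof (rule ccontr)
    assume "\<not> ?thesis"
    then have "(\<chi> j. poly (p j) z) = 0" by (simp add: vec_eq_iff)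
    then have "poly q z *s b = 0" using pencil_at_mult_p[of z] by (simp only: vec.zero)
    then show False using False assms by simp
  qed
qed (rule no_common_root)

text \<open>With \<open>R(s) = (s E - A)\<^sup>-\<^sup>1\<close>, this is the resolvent identity
  \<open>R(s) - R(t) = - (s - t) R(t) E R(s)\<close> applied to \<open>b\<close>.\<close>

lemma resolvent_identity:
  assumes "poly (pencil_det E A) t \<noteq> 0"
  obtains M :: "complex^'n^'n" where "\<And>i. smult (poly q t) (p i) - smult (poly (p i) t) q =
    [:- t, 1:] * smult (- poly q t) (combination (\<lambda>j. M $ i $ j))"
proof -
  let ?B = "\<lambda>s. pencil_at E A (Fin s)" and ?P = "\<lambda>s. \<chi> j. poly (p j) s"
  have "invertible (?B t)" using assms by (simp only: poly_pencil_det invertible_det_nz not_False_eq_True)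
  then have inv: "matrix_inv (?B t) ** ?B t = mat 1" by (rule matrix_inv_mult)
  define M where "M = matrix_inv (?B t) ** E"
  have Bst: "?B t *v v = ?B s *v v - (s - t) *s (E *v v)" for s v
    by (simp add: vec_eq_iff mult_vec_nth sum_distrib_left sum_subtractf sum.distrib algebra_simps)
  \<comment> \<open>The resolvent identity multiplied by \<open>q(s) q(t)\<close>: only the pencil
    at \<open>t\<close> is inverted, so no \<open>s\<close> is excluded.\<close>
  have "poly q t *s ?P s - poly q s *s ?P t = - ((s - t) * poly q t) *s (M *v ?P s)" for s
  proof -
    have "?B t *v (poly q t *s ?P s - poly q s *s ?P t) =
        poly q t *s (?B s *v ?P s - (s - t) *s (E *v ?P s)) - poly q s *s (poly q t *s b)"
      by (simp only: vec.diff vec.scale pencil_at_mult_p Bst[of "?P s" s])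
    also have "\<dots> = - ((s - t) * poly q t) *s (E *v ?P s)"
      unfolding pencil_at_mult_p by (simp add: vec_eq_iff algebra_simps)
    finally have "matrix_inv (?B t) *v (?B t *v (poly q t *s ?P s - poly q s *s ?P t)) =
        matrix_inv (?B t) *v (- ((s - t) * poly q t) *s (E *v ?P s))" by (rule arg_cong)
    then show ?thesis
      by (simp only: matrix_vector_mul_assoc inv matrix_vector_mul_lid vec.scale M_def)
  qed
  then have eq: "poly q t * poly (p i) s - poly q s * poly (p i) t =
      - ((s - t) * poly q t) * (\<Sum>j\<in>UNIV. M $ i $ j * poly (p j) s)" for i s
    by (simp add: vec_eq_iff mult_vec_nth)
  show ?thesis
  proof (rule that[of M])
    fix i
    have "poly (smult (poly q t) (p i) - smult (poly (p i) t) q) s =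
        poly ([:- t, 1:] * smult (- poly q t) (combination (\<lambda>j. M $ i $ j))) s" for s
      using eq[of i s] by (simp add: combination_def poly_sum algebra_simps)
    then show "smult (poly q t) (p i) - smult (poly (p i) t) q =
        [:- t, 1:] * smult (- poly q t) (combination (\<lambda>j. M $ i $ j))" by (rule poly_eq_ext)
  qed
qed

text \<open>When the resolvent identities are weighted by \<open>c\<close> and added, the term with
  \<open>q\<close> carries the factor \<open>poly (combination c) t = 0\<close>; what remains is
  \<open>s - t\<close> times an element of the span.\<close>

lemma combination_divide_root:
  assumes t: "poly (pencil_det E A) t \<noteq> 0" and g: "combination c = [:- t, 1:] * g"
  shows "\<exists>d. g = combination d"
proof -
  obtain M :: "complex^'n^'n" where M: "\<And>i. smult (poly q t) (p i) - smult (poly (p i) t) q =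
    [:- t, 1:] * smult (- poly q t) (combination (\<lambda>j. M $ i $ j))"
    using resolvent_identity[OF t] by blast
  have qt: "poly q t \<noteq> 0" using t by (simp add: det_eq)
  define d where "d j = - (\<Sum>i\<in>UNIV. c i * M $ i $ j)" for j
  have "(\<Sum>i\<in>UNIV. smult (c i) (smult (poly q t) (p i) - smult (poly (p i) t) q)) =
      smult (poly q t) (combination c) - smult (poly (combination c) t) q"
    by (simp add: combination_def smult_diff_right sum_subtractf smult_sum_right poly_sum
        smult_sum[symmetric] mult.commute)
  also have "poly (combination c) t = 0" unfolding g by simp
  finally have "smult (poly q t) (combination c) =
      (\<Sum>i\<in>UNIV. smult (c i) ([:- t, 1:] * smult (- poly q t) (combination (\<lambda>j. M $ i $ j))))"
    unfolding M by simp
  also have "\<dots> = [:- t, 1:] * smult (poly q t) (\<Sum>i\<in>UNIV. smult (- c i) (combination (\<lambda>j. M $ i $ j)))"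
    by (simp add: sum_distrib_left smult_sum_right mult.commute mult.left_commute)
  also have "(\<Sum>i\<in>UNIV. smult (- c i) (combination (\<lambda>j. M $ i $ j))) = combination d"
  proof -
    have "(\<Sum>i\<in>UNIV. smult (- c i) (combination (\<lambda>j. M $ i $ j))) =
        (\<Sum>i\<in>UNIV. \<Sum>j\<in>UNIV. smult (- c i * M $ i $ j) (p j))"
      by (simp add: combination_def smult_sum_right)
    also have "\<dots> = (\<Sum>j\<in>UNIV. \<Sum>i\<in>UNIV. smult (- c i * M $ i $ j) (p j))" by (rule sum.swap)
    also have "\<dots> = combination d"
      by (simp only: combination_def d_def sum_negf[symmetric] smult_sum mult_minus_left)
    finally show ?thesis .
  qed
  finally have "smult (poly q t) ([:- t, 1:] * g) = smult (poly q t) ([:- t, 1:] * combination d)"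
    unfolding g by (simp only: mult_smult_right)
  then have "smult (1 / poly q t) (smult (poly q t) ([:- t, 1:] * g)) =
      smult (1 / poly q t) (smult (poly q t) ([:- t, 1:] * combination d))" by (rule arg_cong)
  moreover have "1 / poly q t * poly q t = 1" using qt by simp
  ultimately have "[:- t, 1:] * g = [:- t, 1:] * combination d" by (simp only: smult_smult smult_1_left)
  then have "g = combination d" unfolding mult_cancel_left by simp
  then show ?thesis by blast
qed

text \<open>Splitting a root off \<open>h0\<close> gives an element of the span of degree one less,
  whose roots are still outside the spectrum. After a multiple of \<open>h0\<close> has removed the
  top coefficient of \<open>g\<close>, the induction applies to the rest.\<close>

lemma combination_all_below:
  assumes "h0 = combination c0" "h0 \<noteq> 0"
    and "\<And>t. poly h0 t = 0 \<Longrightarrow> poly (pencil_det E A) t \<noteq> 0"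
    and "degree g \<le> degree h0"
  shows "\<exists>c. g = combination c"
  using assms
proof (induction "degree h0" arbitrary: h0 c0 g)
  case 0
  obtain a where a: "h0 = [:a:]" using 0 by (metis degree_eq_zeroE)
  obtain e where e: "g = [:e:]" using 0 by (metis degree_eq_zeroE le_zero_eq)
  have "a \<noteq> 0" using 0(3) a by simp
  then have "g = smult (e / a) h0" unfolding a e by simp
  then show ?case unfolding 0(2) combination_smult by blast
next
  case (Suc n)
  have "degree h0 > 0" using Suc.hyps(2) by simp
  then obtain t where t: "poly h0 t = 0" using alg_closed_imp_poly_has_root by blast
  then obtain h1 where h1: "h0 = [:- t, 1:] * h1" by (metis poly_eq_0_iff_dvd dvdE)
  have pt: "poly (pencil_det E A) t \<noteq> 0" using Suc.prems(3) t by blast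
  obtain c1 where c1: "h1 = combination c1"
    using combination_divide_root[OF pt, of c0 h1] Suc.prems(1) h1 by metis
  have h1nz: "h1 \<noteq> 0" using Suc.prems(2) h1 by auto
  have deg: "degree h0 = Suc (degree h1)" unfolding h1 using h1nz by (subst degree_mult_eq) auto
  have roots1: "poly (pencil_det E A) s \<noteq> 0" if "poly h1 s = 0" for s
    using Suc.prems(3)[of s] that h1 by simp
  define r where "r = coeff g (degree h0) / lead_coeff h0"
  define g1 where "g1 = g - smult r h0"
  have "degree g1 \<le> degree h1"
  proof (rule degree_le, intro allI impI)
    fix k assume "degree h1 < k"
    then consider "k = degree h0" | "degree h0 < k" using deg by linarith
    then show "coeff g1 k = 0"
    proof cases
      case 1
      then show ?thesis using Suc.prems(2) by (simp add: g1_def r_def)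
    next
      case 2
      then show ?thesis using Suc.prems(4) by (simp add: g1_def coeff_eq_0)
    qed
  qed
  then obtain c2 where c2: "g1 = combination c2"
    using Suc.hyps(1)[of h1 c1 g1] c1 h1nz roots1 deg Suc.hyps(2) by auto
  have "g = g1 + smult r h0" by (simp add: g1_def)
  then show ?case unfolding c2 Suc.prems(1) combination_smult combination_add by blast
qed

theorem combination_surj:
  assumes b: "b \<noteq> 0" and g: "degree g \<le> max_degree"
  shows "\<exists>c. g = combination c"
proof -
  let ?Z = "{z. poly (pencil_det E A) z = 0}"
  \<comment> \<open>The vectors that a generic \<open>c\<close> must not annihilate: the top
    coefficients, for maximal degree, and the values of \<open>p\<close> at the finite spectrum, to
    keep roots away from it.\<close>
  define F where "F = insert (\<lambda>i. coeff (p i) max_degree) ((\<lambda>z i. poly (p i) z) ` ?Z)"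
  have "finite F" unfolding F_def using poly_roots_finite[OF nonzero(3)] by simp
  moreover have "\<exists>i. a i \<noteq> 0" if a: "a \<in> F" for a
  proof -
    consider "a = (\<lambda>i. coeff (p i) max_degree)" | z where "a = (\<lambda>i. poly (p i) z)"
      using a unfolding F_def by blast
    then show ?thesis
    proof cases
      case 1
      obtain i where i: "degree (p i) = max_degree" using max_degree_attained by blast
      show ?thesis
      proof (cases "p i = 0")
        case False
        then have "coeff (p i) max_degree \<noteq> 0" unfolding i[symmetric] by simp
        then show ?thesis unfolding 1 by blast
      next
        case True
        \<comment> \<open>The maximal degree may be attained by a zero entry, but then all entries
          are constant.\<close>
        then have m: "max_degree = 0" using i by simp
        obtain k where k: "poly (p k) 0 \<noteq> 0" using p_no_common_root[OF b] by blast
        then have "coeff (p k) max_degree \<noteq> 0" unfolding m by (simp add: poly_0_coeff_0)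
        then show ?thesis unfolding 1 by blast
      qed
    next
      case 2
      then show ?thesis using p_no_common_root[OF b] by simp
    qed
  qed
  ultimately obtain c where c: "\<And>a. a \<in> F \<Longrightarrow> (\<Sum>i\<in>UNIV. c i * a i) \<noteq> 0"
    using exists_nonvanishing_combination[of F] by blast
  have "(\<Sum>i\<in>UNIV. c i * coeff (p i) max_degree) \<noteq> 0" by (rule c) (simp add: F_def)
  then have cf: "coeff (combination c) max_degree \<noteq> 0" by (simp add: combination_def coeff_sum)
  then have "max_degree \<le> degree (combination c)" by (rule le_degree)
  moreover have "combination c \<noteq> 0" using cf by auto
  moreover have "poly (pencil_det E A) t \<noteq> 0" if "poly (combination c) t = 0" for t
  proof
    assume "poly (pencil_det E A) t = 0"
    then have "(\<Sum>i\<in>UNIV. c i * poly (p i) t) \<noteq> 0" by (intro c) (simp add: F_def)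
    then show False using that by (simp add: combination_def poly_sum)
  qed
  ultimately show ?thesis using combination_all_below[OF refl] g by (meson order_trans)
qed

text \<open>At some \<open>t\<close> with \<open>poly (p i) t\<close> nonzero, the resolvent
  identity expresses \<open>q\<close> through \<open>p i\<close> and \<open>s - t\<close> times an
  element of the span.\<close>

lemma degree_q_le:
  assumes "b \<noteq> 0"
  shows "degree q \<le> Suc max_degree"
proof -
  have "finite {t. poly (pencil_det E A) t = 0}" by (rule poly_roots_finite[OF nonzero(3)])
  then obtain t where t: "poly (pencil_det E A) t \<noteq> 0"
    using ex_new_if_finite[OF infinite_UNIV_char_0] by blast
  obtain M :: "complex^'n^'n" where M: "\<And>i. smult (poly q t) (p i) - smult (poly (p i) t) q =
    [:- t, 1:] * smult (- poly q t) (combination (\<lambda>j. M $ i $ j))"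
    using resolvent_identity[OF t] by blast
  obtain i where i: "poly (p i) t \<noteq> 0" using p_no_common_root[OF assms] by blast
  have comb: "degree (combination c) \<le> max_degree" for c
    unfolding combination_def
    by (rule degree_sum_le[OF finite_class.finite_UNIV order_trans[OF degree_smult_le degree_le_max_degree]])
  have "degree ([:- t, 1:] * smult (- poly q t) (combination (\<lambda>j. M $ i $ j))) \<le>
      degree [:- t, 1:] + degree (smult (- poly q t) (combination (\<lambda>j. M $ i $ j)))"
    by (rule degree_mult_le)
  also have "\<dots> \<le> Suc max_degree"
    using order_trans[OF degree_smult_le comb] by simp
  finally have 1: "degree (smult (poly q t) (p i) - smult (poly (p i) t) q) \<le> Suc max_degree"
    unfolding M .
  have 2: "degree (smult (poly q t) (p i)) \<le> Suc max_degree"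
    using order_trans[OF degree_smult_le degree_le_max_degree] by (simp add: le_SucI)
  have "smult (poly (p i) t) q = smult (poly q t) (p i) - (smult (poly q t) (p i) - smult (poly (p i) t) q)"
    by simp
  then have "degree (smult (poly (p i) t) q) \<le> Suc max_degree"
    using degree_diff_le[OF 2 1] by metis
  then show ?thesis using i by simp
qed

lemma degree_h_max_degree: "p i \<noteq> 0 \<Longrightarrow> degree h + max_degree < CARD('n)"
proof -
  assume pi: "p i \<noteq> 0"
  obtain k where k: "degree (p k) = max_degree" using max_degree_attained by blast
  obtain j where j: "p j \<noteq> 0" "degree (p j) = max_degree"
  proof (cases "p k = 0")
    case True
    then have "max_degree = 0" using k by simp
    then have "degree (p i) = max_degree" using degree_le_max_degree[of i] by simp
    then show ?thesis using that pi by blast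
  qed (use that k in blast)
  have "degree (cramer_poly E A b j) = degree h + max_degree"
    unfolding cramer_eq using j nonzero(1) by (simp add: degree_mult_eq)
  then show ?thesis using degree_cramer_poly[of E A b j] by simp
qed

end

text \<open>Common roots of the determinant and all Cramer polynomials are split off one linear
  factor at a time; when none is left, the leading coefficient goes into \<open>h\<close> to make
  \<open>q\<close> monic.\<close>

lemma reduced_pencil_exists:
  fixes E A :: "complex^'n^'n"
  assumes "regular_pencil E A"
  shows "\<exists>h q p. reduced_pencil E A b h q p"
proof -
  have "\<exists>h q p. H = h * q \<and> (\<forall>i. c i = h * p i) \<and> lead_coeff q = 1 \<and>
      (\<forall>z. poly q z = 0 \<longrightarrow> (\<exists>i. poly (p i) z \<noteq> 0))"
    if "H \<noteq> 0" for H :: "complex poly" and c :: "'n \<Rightarrow> complex poly"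
    using that
  proof (induction "degree H" arbitrary: H c rule: less_induct)
    case less
    show ?case
    proof (cases "\<exists>z. poly H z = 0 \<and> (\<forall>i. poly (c i) z = 0)")
      case True
      then obtain z where z: "poly H z = 0" "\<And>i. poly (c i) z = 0" by blast
      obtain H1 where H1: "H = [:- z, 1:] * H1" using z(1) by (metis poly_eq_0_iff_dvd dvdE)
      have "\<forall>i. \<exists>d. c i = [:- z, 1:] * d" using z(2) by (metis poly_eq_0_iff_dvd dvdE)
      then obtain c1 where c1: "\<And>i. c i = [:- z, 1:] * c1 i" by metis
      have "H1 \<noteq> 0" using less.prems H1 by auto
      moreover from this have "degree H1 < degree H" unfolding H1 by (subst degree_mult_eq) auto
      ultimately obtain h q p where "H1 = h * q" "\<forall>i. c1 i = h * p i" "lead_coeff q = 1"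
        "\<forall>z. poly q z = 0 \<longrightarrow> (\<exists>i. poly (p i) z \<noteq> 0)"
        using less.hyps[of H1 c1] by blast
      then show ?thesis using H1 c1
        by (intro exI[of _ "[:- z, 1:] * h"] exI[of _ q] exI[of _ p]) (simp only: mult.assoc simp_thms)
    next
      case False
      let ?l = "lead_coeff H"
      have l: "?l \<noteq> 0" using less.prems by simp
      show ?thesis
      proof (intro exI conjI allI)
        show "H = [:?l:] * smult (1 / ?l) H" using l by simp
        show "c i = [:?l:] * smult (1 / ?l) (c i)" for i using l by simp
        show "lead_coeff (smult (1 / ?l) H) = 1" using l by simp
        show "poly (smult (1 / ?l) H) z = 0 \<longrightarrow> (\<exists>i. poly (smult (1 / ?l) (c i)) z \<noteq> 0)" for z
          using False l by auto
      qed
    qed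
  qed
  from this[of "pencil_det E A" "cramer_poly E A b"] assms
  obtain h q p where "pencil_det E A = h * q" "\<And>i. cramer_poly E A b i = h * p i" "lead_coeff q = 1"
    "\<And>z. poly q z = 0 \<Longrightarrow> \<exists>i. poly (p i) z \<noteq> 0"
    unfolding regular_pencil_iff by metis
  then have "reduced_pencil E A b h q p" using assms by unfold_locales
  then show ?thesis by blast
qed

section \<open>Pole placement\<close>

lemma monic_eqI_order:
  fixes p q :: "complex poly"
  assumes "lead_coeff p = 1" "lead_coeff q = 1" "\<And>z. order z p = order z q"
  shows "p = q"
proof -
  have nz: "p \<noteq> 0" "q \<noteq> 0" using assms by auto
  have "poly p z = 0 \<longleftrightarrow> poly q z = 0" for z
    using nz assms(3)[of z] by (simp add: order_root)
  then have "(\<Prod>z | poly p z = 0. [:- z, 1:] ^ order z p) = (\<Prod>z | poly q z = 0. [:- z, 1:] ^ order z q)"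
    by (simp only: assms(3))
  then show ?thesis
    using complex_poly_decompose[of p] complex_poly_decompose[of q] unfolding assms(1,2) by simp
qed

lemma order_linear_power: "order z ([:- w, 1:] ^ k) = (if w = z then k else 0)"
  for w z :: "'a::idom"
  by (cases "w = z") (auto simp: order_power_n_n poly_power intro!: order_0I)

lemma order_prod_eq_sum:
  assumes "finite S" "\<And>i. i \<in> S \<Longrightarrow> F i \<noteq> (0 :: 'a::idom poly)"
  shows "order z (\<Prod>i\<in>S. F i) = (\<Sum>i\<in>S. order z (F i))"
  using assms by (induction S) (simp_all add: order_mult)

lemma degree_diff_monic_le:
  assumes "lead_coeff q = 1" "lead_coeff r = 1" "degree q = degree r" "degree q \<le> Suc k"
  shows "degree (q - r) \<le> k"
proof (rule degree_le, intro allI impI)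
  fix j assume "k < j"
  then consider "j = degree q" | "degree q < j" using assms(4) by linarith
  then show "coeff (q - r) j = 0"
  proof cases
    case 1
    then show ?thesis using assms by simp
  next
    case 2
    then show ?thesis using assms(3) by (simp add: coeff_eq_0)
  qed
qed

section \<open>Complex conjugation and real data\<close>

lemma lead_coeff_map_poly_cnj: "lead_coeff (map_poly cnj P) = cnj (lead_coeff P)"
  by (simp add: coeff_map_poly degree_map_poly)

lemma map_poly_cnj_mult: "map_poly cnj (P * Q) = map_poly cnj P * map_poly cnj Q"
  by (rule poly_eq_ext) simp

lemma order_map_poly_cnj:
  assumes "P \<noteq> 0"
  shows "order z (map_poly cnj P) = order (cnj z) P"
proof -
  obtain P' where P': "P = [:- cnj z, 1:] ^ order (cnj z) P * P'" "poly P' (cnj z) \<noteq> 0"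
    using order_factor[OF assms] .
  have "map_poly cnj P = [:- z, 1:] ^ order (cnj z) P * map_poly cnj P'"
    by (rule poly_eq_ext, subst P'(1)) (simp add: poly_power)
  moreover have "poly (map_poly cnj P') z \<noteq> 0" using P'(2) by simp
  moreover from this have "map_poly cnj P' \<noteq> 0" by force
  ultimately show ?thesis by (simp add: order_mult order_power_n_n order_0I)
qed

lemma det_cnj: "det (\<chi> i j. cnj (M $ i $ j)) = cnj (det (M :: complex^'n^'n))"
  by (simp add: det_def cnj_sum cnj_prod)

lemma map_poly_cnj_pencil_det:
  assumes "real_mat E" "real_mat A"
  shows "map_poly cnj (pencil_det E A) = pencil_det E A"
proof (rule poly_eq_ext)
  fix s
  have "pencil_at E A (Fin s) = (\<chi> i j. cnj (pencil_at E A (Fin (cnj s)) $ i $ j))"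
    using assms by (simp add: real_mat_def vec_eq_iff Reals_cnj_iff)
  then show "poly (map_poly cnj (pencil_det E A)) s = poly (pencil_det E A) s"
    unfolding poly_map_poly_cnj poly_pencil_det by (simp only: det_cnj)
qed

lemma map_poly_cnj_cramer_poly:
  assumes "real_mat E" "real_mat A" "real_vec b"
  shows "map_poly cnj (cramer_poly E A b k) = cramer_poly E A b k"
proof (rule poly_eq_ext)
  fix s
  let ?M = "\<lambda>s. \<chi> i j. if j = k then b $ i else pencil_at E A (Fin s) $ i $ j"
  have "?M s = (\<chi> i j. cnj (?M (cnj s) $ i $ j))"
    using assms by (simp add: real_mat_def real_vec_def vec_eq_iff Reals_cnj_iff)
  then show "poly (map_poly cnj (cramer_poly E A b k)) s = poly (cramer_poly E A b k) s"
    unfolding poly_map_poly_cnj poly_cramer_poly by (simp only: det_cnj)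
qed

context reduced_pencil
begin

lemma dim_Fin: "vec.dim (root_subspace E A (Fin z)) = order z h + order z q"
  using dim_root_subspace_Fin[OF regular, of z] nonzero by (simp add: det_eq order_mult)

lemma dim_Infty: "vec.dim (root_subspace E A Infty) + degree h + degree q = CARD('n)"
  using dim_root_subspace_Infty[OF regular] nonzero by (simp add: det_eq degree_mult_eq)

lemma Fin_mem_spectrum: "Fin z \<in> pencil_spectrum E A \<longleftrightarrow> poly (pencil_det E A) z = 0"
  by (simp only: pencil_spectrum_def mem_Collect_eq poly_pencil_det invertible_det_nz not_not)

lemma Infty_mem_spectrum: "Infty \<in> pencil_spectrum E A \<longleftrightarrow> \<not> invertible E"
  by (simp add: pencil_spectrum_def)

text \<open>If \<open>max_degree > degree q\<close>, some Cramer polynomial has degree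
  \<open>degree h + max_degree\<close>, which is below \<open>n\<close>, while the dimension at
  infinity is \<open>n - degree h - degree q\<close>. The strictness agrees with \<open>E\<close>
  being unchanged by feedback, so that infinity stays in the spectrum.\<close>

lemma m0_Infty_less:
  assumes "Infty \<in> pencil_spectrum E A"
  shows "m0 E A (- b) Infty < vec.dim (root_subspace E A Infty)"
proof (cases "max_degree \<le> degree q")
  case True
  then show ?thesis using assms unfolding m0_Infty pencil_spectrum_iff by linarith
next
  case False
  obtain i where "degree (p i) = max_degree" using max_degree_attained by blast
  then have "p i \<noteq> 0" using False by auto
  then show ?thesis using degree_h_max_degree dim_Infty False unfolding m0_Infty by fastforce
qed

lemma m0_le_dim:
  assumes "x \<in> pencil_spectrum E A"
  shows "m0 E A (- b) x \<le> vec.dim (root_subspace E A x)"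
proof (cases x)
  case (Fin z)
  then show ?thesis unfolding Fin m0_Fin dim_Fin by simp
next
  case Infty
  then show ?thesis using m0_Infty_less assms by (simp del: m0.simps)
qed

text \<open>A finite point with a kernel of dimension at least two is a root of all Cramer
  polynomials, hence of \<open>h\<close>. With a one-dimensional kernel the longest chain has the
  dimension of the root subspace as its length. At infinity the right side always holds.\<close>

lemma m0_less_dim_iff:
  assumes x: "x \<in> pencil_spectrum E A"
  shows "ker_dim (pencil_at E A x) \<ge> 2 \<or> m0 E A (- b) x < max_chain_length E A x \<longleftrightarrow>
    m0 E A (- b) x < vec.dim (root_subspace E A x)" (is "?L \<longleftrightarrow> ?R")
proof
  assume ?R
  show ?L
  proof (cases "ker_dim (pencil_at E A x) \<ge> 2")
    case False
    then have "vec.dim (root_subspace E A x) \<le> max_chain_length E A x"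
      by (intro max_chain_length_ge[OF regular x]) linarith
    then show ?thesis using \<open>?R\<close> by linarith
  qed blast
next
  assume ?L
  show ?R
  proof (cases x)
    case (Fin z)
    show ?thesis
    proof (cases "ker_dim (pencil_at E A x) \<ge> 2")
      case True
      have "poly h z = 0"
      proof (rule ccontr)
        assume hz: "poly h z \<noteq> 0"
        have "poly (cramer_poly E A b i) z = 0" for i
          using True unfolding Fin by (rule cramer_poly_root_if_ker_dim)
        then have "poly (p i) z = 0" for i using hz by (simp add: cramer_eq)
        moreover have "poly q z = 0" using x hz unfolding Fin Fin_mem_spectrum det_eq by simp
        ultimately show False using no_common_root by blast
      qed
      then have "order z h \<noteq> 0" using nonzero(1) by (simp add: order_root)
      then show ?thesis unfolding Fin m0_Fin dim_Fin by simp
    next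
      case False
      then show ?thesis using \<open>?L\<close> max_chain_length_le[OF regular x] by linarith
    qed
  next
    case Infty
    then show ?thesis using m0_Infty_less x by (simp del: m0.simps)
  qed
qed

end

text \<open>Being 0 at points that are not prescribed, it merges the four cases of
  \<open>target_root_dims\<close> into one balance equation; for injective \<open>\<mu>\<close> the
  sum has at most one nonzero term.\<close>

definition multiplicity_at :: "nat \<Rightarrow> (nat \<Rightarrow> ext_complex) \<Rightarrow> (nat \<Rightarrow> nat) \<Rightarrow> ext_complex \<Rightarrow> nat" where
  "multiplicity_at l \<mu> m x = (\<Sum>i=1..l. if \<mu> i = x then m i else 0)"

text \<open>The factor at \<open>Infty\<close> is 1: a pole placed at infinity shows up as a drop of the degree.\<close>

fun point_poly :: "ext_complex \<Rightarrow> nat \<Rightarrow> complex poly" where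
  "point_poly (Fin z) k = [:- z, 1:] ^ k"
| "point_poly Infty k = 1"

definition placed_poly :: "nat \<Rightarrow> (nat \<Rightarrow> ext_complex) \<Rightarrow> (nat \<Rightarrow> nat) \<Rightarrow> complex poly" where
  "placed_poly l \<mu> m = (\<Prod>i=1..l. point_poly (\<mu> i) (m i))"

lemma multiplicity_at_eq:
  assumes "inj_on \<mu> {1..l}" "i \<in> {1..l}"
  shows "multiplicity_at l \<mu> m (\<mu> i) = m i"
proof -
  have "multiplicity_at l \<mu> m (\<mu> i) = (\<Sum>j=1..l. if j = i then m j else 0)"
    unfolding multiplicity_at_def by (rule sum.cong) (simp_all only: inj_on_eq_iff[OF assms(1) _ assms(2)])
  then show ?thesis using assms(2) by simp
qed

lemma multiplicity_at_eq_0: "x \<notin> \<mu> ` {1..l} \<Longrightarrow> multiplicity_at l \<mu> m x = 0"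
  unfolding multiplicity_at_def by (rule sum.neutral) (metis imageI)

lemma point_poly_nonzero: "point_poly x k \<noteq> 0"
  by (cases x) simp_all

lemma order_point_poly: "order z (point_poly x k) = (if x = Fin z then k else 0)"
  by (cases x) (simp_all add: order_linear_power order_0I)

lemma order_placed_poly: "order z (placed_poly l \<mu> m) = multiplicity_at l \<mu> m (Fin z)"
  unfolding placed_poly_def multiplicity_at_def
  by (subst order_prod_eq_sum) (simp_all add: point_poly_nonzero order_point_poly)

lemma placed_poly_monic: "lead_coeff (placed_poly l \<mu> m) = 1"
proof -
  have "lead_coeff (point_poly x k) = 1" for x k
    by (cases x) (simp_all add: lead_coeff_power)
  then show ?thesis unfolding placed_poly_def lead_coeff_prod by simp
qed

lemma degree_placed_poly: "degree (placed_poly l \<mu> m) + multiplicity_at l \<mu> m Infty = (\<Sum>i=1..l. m i)"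
proof -
  have "degree (point_poly x k) + (if x = Infty then k else 0) = k" for x k
    by (cases x) (simp_all add: degree_power_eq)
  moreover have "degree (placed_poly l \<mu> m) = (\<Sum>i=1..l. degree (point_poly (\<mu> i) (m i)))"
    unfolding placed_poly_def by (rule degree_prod_sum_eq) (simp add: point_poly_nonzero)
  ultimately show ?thesis unfolding multiplicity_at_def by (simp add: sum.distrib[symmetric])
qed

lemma multiplicity_at_cnj:
  assumes inj: "inj_on \<mu> {1..l}" and sym: "conj_symmetric l \<mu> m"
  shows "multiplicity_at l \<mu> m (Fin (cnj z)) = multiplicity_at l \<mu> m (Fin z)"
proof (cases "Fin z \<in> \<mu> ` {1..l}")
  case True
  then obtain i where i: "i \<in> {1..l}" "\<mu> i = Fin z" by (metis imageE)
  then obtain j where j: "j \<in> {1..l}" "\<mu> j = Fin (cnj z)" "m j = m i"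
    using sym unfolding conj_symmetric_def by blast
  show ?thesis
    using multiplicity_at_eq[OF inj i(1), of m] multiplicity_at_eq[OF inj j(1), of m] i j by simp
next
  case False
  have "Fin (cnj z) \<notin> \<mu> ` {1..l}"
  proof
    assume "Fin (cnj z) \<in> \<mu> ` {1..l}"
    then obtain i where i: "i \<in> {1..l}" "\<mu> i = Fin (cnj z)" by (metis imageE)
    then obtain j where "j \<in> {1..l}" "\<mu> j = Fin (cnj (cnj z))"
      using sym unfolding conj_symmetric_def by blast
    then have "Fin z \<in> \<mu> ` {1..l}" by (metis complex_cnj_cnj imageI)
    then show False using False by contradiction
  qed
  then show ?thesis using False by (simp add: multiplicity_at_eq_0)
qed

lemma map_poly_cnj_placed_poly:
  assumes "inj_on \<mu> {1..l}" "conj_symmetric l \<mu> m"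
  shows "map_poly cnj (placed_poly l \<mu> m) = placed_poly l \<mu> m"
proof (rule monic_eqI_order)
  have nz: "placed_poly l \<mu> m \<noteq> 0" using placed_poly_monic[of l \<mu> m] by auto
  show "lead_coeff (map_poly cnj (placed_poly l \<mu> m)) = 1"
    unfolding lead_coeff_map_poly_cnj placed_poly_monic by simp
  show "order z (map_poly cnj (placed_poly l \<mu> m)) = order z (placed_poly l \<mu> m)" for z
    unfolding order_map_poly_cnj[OF nz] order_placed_poly by (rule multiplicity_at_cnj[OF assms])
qed (rule placed_poly_monic)

context reduced_pencil
begin

text \<open>Conjugating \<open>h\<close>, \<open>q\<close> and \<open>p\<close> gives another
  reduced form of the same real data. The orders of \<open>q\<close> are values of
  \<open>m0\<close>, which do not depend on the reduced form, so the monic \<open>q\<close> is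
  unique, and \<open>h\<close> and \<open>p\<close> follow.\<close>

lemma reduced_pencil_real:
  assumes "real_mat E" "real_mat A" "real_vec b"
  shows "map_poly cnj q = q" "map_poly cnj (p i) = p i"
proof -
  have det: "map_poly cnj h * map_poly cnj q = h * q"
    using map_poly_cnj_pencil_det[OF assms(1,2)] unfolding det_eq map_poly_cnj_mult .
  have cr: "map_poly cnj h * map_poly cnj (p i) = h * p i" for i
    using map_poly_cnj_cramer_poly[OF assms, of i] unfolding cramer_eq map_poly_cnj_mult .
  interpret c: reduced_pencil E A b "map_poly cnj h" "map_poly cnj q" "\<lambda>i. map_poly cnj (p i)"
  proof
    show "regular_pencil E A" by (rule regular)
    show "pencil_det E A = map_poly cnj h * map_poly cnj q" unfolding det det_eq ..
    show "cramer_poly E A b i = map_poly cnj h * map_poly cnj (p i)" for i unfolding cr cramer_eq ..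
    show "lead_coeff (map_poly cnj q) = 1" unfolding lead_coeff_map_poly_cnj monic by simp
    show "\<exists>i. poly (map_poly cnj (p i)) z \<noteq> 0" if "poly (map_poly cnj q) z = 0" for z
      using no_common_root[of "cnj z"] that by simp
  qed
  show q: "map_poly cnj q = q"
    by (rule monic_eqI_order[OF c.monic monic]) (simp only: c.m0_Fin[symmetric] m0_Fin[symmetric])
  have "map_poly cnj h = h" using det nonzero(2) unfolding q mult_cancel_right by blast
  then show "map_poly cnj (p i) = p i" using cr[of i] nonzero(1) by simp
qed

lemma p_eq_0: "b = 0 \<Longrightarrow> p i = 0"
proof (rule poly_eqI_off_roots[OF nonzero(3)])
  fix s assume "b = 0" and s: "poly (pencil_det E A) s \<noteq> 0"
  then have "poly (p i) s / poly q s = 0" using resolvent_eq[OF s, of i] by simp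
  moreover have "poly q s \<noteq> 0" using s by (simp add: det_eq)
  ultimately show "poly (p i) s = poly 0 s" by simp
qed

lemma places_feedback:
  assumes inj: "inj_on \<mu> {1..l}" and m: "\<And>i. i \<in> {1..l} \<Longrightarrow> m i \<noteq> 0"
    and sum_m: "(\<Sum>i=1..l. m i) = M0 E A (- b)"
    and f: "combination (\<lambda>i. cnj (f $ i)) = q - placed_poly l \<mu> m"
  shows "places E A b l \<mu> m f"
proof -
  let ?r = "placed_poly l \<mu> m" and ?A = "A + outer b f" and ?\<nu> = "multiplicity_at l \<mu> m"
  let ?S = "pencil_spectrum E A"
  have r0: "?r \<noteq> 0" using placed_poly_monic[of l \<mu> m] by auto
  have "(\<Sum>k\<in>UNIV. smult (cnj (f $ k)) (cramer_poly E A b k)) = h * combination (\<lambda>i. cnj (f $ i))"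
    by (simp add: combination_def cramer_eq sum_distrib_left)
  then have det': "pencil_det E ?A = h * ?r"
    unfolding pencil_det_feedback det_eq f by (simp add: algebra_simps)
  have regular': "regular_pencil E ?A"
    unfolding regular_pencil_iff det' using nonzero(1) r0 by simp
  let ?d = "\<lambda>x. vec.dim (root_subspace E A x)" and ?d' = "\<lambda>x. vec.dim (root_subspace E ?A x)"
  \<comment> \<open>The balance of dimensions, from which the four cases and the spectrum are read
    off.\<close>
  have main: "?d' x + (if x \<in> ?S then m0 E A (- b) x else 0) = ?d x + ?\<nu> x" for x
  proof (cases x)
    case (Fin z)
    have "?d' (Fin z) = order z h + order z ?r"
      unfolding dim_root_subspace_Fin[OF regular'] det' using nonzero(1) r0 by (simp add: order_mult)
    moreover have "(if Fin z \<in> ?S then m0 E A (- b) (Fin z) else 0) = order z q"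
      unfolding Fin_mem_spectrum m0_Fin det_eq by (auto simp: order_0I)
    ultimately show ?thesis unfolding Fin dim_Fin order_placed_poly by simp
  next
    case Infty
    have "?d' Infty + degree h + degree ?r = CARD('n)"
      using dim_root_subspace_Infty[OF regular'] nonzero(1) r0 unfolding det' by (simp add: degree_mult_eq)
    \<comment> \<open>Multiplicity placed at infinity is paid for by the degree of the target: both
      sides equal \<open>M0\<close>.\<close>
    moreover have "degree ?r + ?\<nu> Infty = degree q + (if Infty \<in> ?S then m0 E A (- b) Infty else 0)"
      using degree_placed_poly[of l \<mu> m] unfolding sum_m M0_eq m0_Infty Infty_mem_spectrum by simp
    ultimately show ?thesis using dim_Infty unfolding Infty by linarith
  qed
  have d0: "?d x = 0" if "x \<notin> ?S" for x using that unfolding pencil_spectrum_iff by blast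
  have \<nu>pos: "?\<nu> x \<noteq> 0 \<longleftrightarrow> x \<in> \<mu> ` {1..l}" for x
  proof
    assume "x \<in> \<mu> ` {1..l}"
    then obtain i where i: "x = \<mu> i" "i \<in> {1..l}" by (rule imageE)
    show "?\<nu> x \<noteq> 0" using m[OF i(2)] unfolding i(1) multiplicity_at_eq[OF inj i(2)] .
  next
    assume "?\<nu> x \<noteq> 0"
    then show "x \<in> \<mu> ` {1..l}" using multiplicity_at_eq_0[of x \<mu> l m] by metis
  qed
  have "pencil_spectrum E ?A = target_spectrum E A b l \<mu>"
  proof (rule set_eqI)
    fix x
    have "x \<in> target_spectrum E A b l \<mu> \<longleftrightarrow> ?\<nu> x \<noteq> 0 \<or> (x \<in> ?S \<and> m0 E A (- b) x < ?d x)"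
      unfolding target_spectrum_def \<nu>pos using m0_less_dim_iff[of x] by blast
    also have "\<dots> \<longleftrightarrow> ?d' x \<noteq> 0"
    proof (cases "x \<in> ?S")
      case True
      \<comment> \<open>Without \<open>k \<le> d\<close> a positive \<open>n\<close> could be used
        up by the excess of \<open>k\<close> over \<open>d\<close>.\<close>
      have aux: "(n \<noteq> 0 \<or> k < d) \<longleftrightarrow> d' \<noteq> 0" if "d' + k = d + n" "k \<le> d" for d d' k n :: nat
        using that by auto
      have "?d' x + m0 E A (- b) x = ?d x + ?\<nu> x" using main[of x] True by (simp only: if_True)
      from aux[OF this m0_le_dim[OF True]] True show ?thesis by (simp only: simp_thms)
    next
      case False
      then show ?thesis using main[of x] d0[OF False] by simp
    qed
    also have "\<dots> \<longleftrightarrow> x \<in> pencil_spectrum E ?A" unfolding pencil_spectrum_iff ..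
    finally show "x \<in> pencil_spectrum E ?A \<longleftrightarrow> x \<in> target_spectrum E A b l \<mu>" by blast
  qed
  moreover have "target_root_dims E A b l \<mu> m f"
  proof -
    have 1: "int (?d' (\<mu> i)) = int (?d (\<mu> i)) - int (m0 E A (- b) (\<mu> i)) + int (m i)"
      if "i \<in> {1..l}" "\<mu> i \<in> ?S" for i
      using main[of "\<mu> i"] that(2) unfolding multiplicity_at_eq[OF inj that(1)] by simp
    have 2: "int (?d' x) = int (?d x) - int (m0 E A (- b) x)" if "x \<in> ?S - \<mu> ` {1..l}" for x
      using main[of x] that \<nu>pos[of x] by simp
    have 3: "int (?d' (\<mu> i)) = int (m i)" if "i \<in> {1..l}" "\<mu> i \<notin> ?S" for i
      using main[of "\<mu> i"] that(2) d0 unfolding multiplicity_at_eq[OF inj that(1)] by simp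
    have 4: "int (?d' x) = 0" if "x \<notin> ?S \<union> \<mu> ` {1..l}" for x
      using main[of x] that \<nu>pos[of x] d0[of x] by simp
    show ?thesis unfolding target_root_dims_def Let_def using 1 2 3 4 by blast
  qed
  ultimately show ?thesis unfolding places_def using regular' by blast
qed

text \<open>If \<open>E\<close> is singular and \<open>degree q \<le> max_degree\<close>, the
  multiplicities add up to \<open>max_degree\<close>, which bounds both degrees. Otherwise infinity
  is not prescribed, both polynomials are monic of the same degree, and cancellation of the leading
  terms leaves degree at most \<open>max_degree\<close> by \<open>degree_q_le\<close>. For
  \<open>b = 0\<close> both polynomials are 1.\<close>

lemma placed_poly_attained:
  assumes sum_m: "(\<Sum>i=1..l. m i) = M0 E A (- b)"
    and Infty: "Infty \<in> \<mu> ` {1..l} \<Longrightarrow> \<not> invertible E \<and> acts_at_infinity E A b"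
  shows "\<exists>c. q - placed_poly l \<mu> m = combination c"
proof (cases "b = 0")
  case True
  then have p0: "p i = 0" for i by (rule p_eq_0)
  have "degree q = 0"
    using no_common_root alg_closed_imp_poly_has_root[of q] p0 by fastforce
  moreover have "max_degree = 0" using max_degree_attained p0 by auto
  ultimately have "degree (placed_poly l \<mu> m) = 0"
    using degree_placed_poly[of l \<mu> m] unfolding sum_m M0_eq by (simp split: if_splits)
  then have "q = placed_poly l \<mu> m"
    using \<open>degree q = 0\<close> monic placed_poly_monic[of l \<mu> m] by (metis degree_eq_zeroE lead_coeff_pCons(2) pCons_0_0)
  then have "q - placed_poly l \<mu> m = combination (\<lambda>_. 0)" by (simp add: combination_def)
  then show ?thesis by blast
next
  case False
  let ?r = "placed_poly l \<mu> m"
  have deg: "degree ?r + multiplicity_at l \<mu> m Infty = degree q + (if invertible E then 0 else max_degree - degree q)"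
    using degree_placed_poly[of l \<mu> m] unfolding sum_m M0_eq .
  have "degree (q - ?r) \<le> max_degree"
  proof (cases "\<not> invertible E \<and> degree q \<le> max_degree")
    case True
    then have "degree ?r \<le> max_degree" using deg by simp
    then show ?thesis using True by (intro degree_diff_le) blast+
  next
    case F: False
    have "Infty \<notin> \<mu> ` {1..l}" using Infty acts_at_infinity_degree F by blast
    then have "multiplicity_at l \<mu> m Infty = 0" by (rule multiplicity_at_eq_0)
    then have "degree q = degree ?r" using deg F by (auto split: if_splits)
    then show ?thesis
      by (rule degree_diff_monic_le[OF monic placed_poly_monic _ degree_q_le[OF False]])
  qed
  then show ?thesis by (rule combination_surj[OF False])
qed

lemma placement:
  assumes "inj_on \<mu> {1..l}" "\<And>i. i \<in> {1..l} \<Longrightarrow> m i \<noteq> 0"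
    and "(\<Sum>i=1..l. m i) = M0 E A (- b)"
    and "Infty \<in> \<mu> ` {1..l} \<Longrightarrow> \<not> invertible E \<and> acts_at_infinity E A b"
  shows "\<exists>f. places E A b l \<mu> m f"
    and "real_mat E \<Longrightarrow> real_mat A \<Longrightarrow> real_vec b \<Longrightarrow> conj_symmetric l \<mu> m \<Longrightarrow>
      \<exists>f. real_vec f \<and> places E A b l \<mu> m f"
proof -
  obtain c where c: "combination c = q - placed_poly l \<mu> m"
    using placed_poly_attained[OF assms(3,4)] by metis
  have "combination (\<lambda>i. cnj ((\<chi> i. cnj (c i)) $ i)) = q - placed_poly l \<mu> m"
    using c by simp
  from places_feedback[OF assms(1-3) this] show "\<exists>f. places E A b l \<mu> m f" by blast
  assume re: "real_mat E" "real_mat A" "real_vec b" and sym: "conj_symmetric l \<mu> m"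
  have "combination (\<lambda>i. cnj (c i)) = map_poly cnj (combination c)"
  proof (rule poly_eq_ext)
    fix s
    have "poly (p i) (cnj s) = cnj (poly (p i) s)" for i
      using arg_cong[OF reduced_pencil_real(2)[OF re, of i], of "\<lambda>P. cnj (poly P s)"] by simp
    then show "poly (combination (\<lambda>i. cnj (c i))) s = poly (map_poly cnj (combination c)) s"
      by (simp add: combination_def poly_sum cnj_sum)
  qed
  also have "\<dots> = q - placed_poly l \<mu> m"
  proof (rule poly_eq_ext)
    fix s
    have "cnj (poly q (cnj s)) = poly q s"
      "cnj (poly (placed_poly l \<mu> m) (cnj s)) = poly (placed_poly l \<mu> m) s"
      using reduced_pencil_real(1)[OF re] map_poly_cnj_placed_poly[OF assms(1) sym]
      by (simp_all only: poly_map_poly_cnj[symmetric])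
    then show "poly (map_poly cnj (combination c)) s = poly (q - placed_poly l \<mu> m) s"
      unfolding c by simp
  qed
  finally have cc: "combination (\<lambda>i. cnj (c i)) = q - placed_poly l \<mu> m" .
  \<comment> \<open>\<open>c\<close> and its conjugate solve the same affine equation, hence so does
    their mean.\<close>
  let ?f = "(\<chi> i. of_real (Re (c i))) :: complex^'n"
  have "combination (\<lambda>i. cnj (?f $ i)) = combination (\<lambda>i. 1 / 2 * (c i + cnj (c i)))"
    by (simp add: complex_add_cnj)
  also have "\<dots> = smult (1 / 2) (combination c + combination (\<lambda>i. cnj (c i)))"
    unfolding combination_add combination_smult ..
  also have "\<dots> = q - placed_poly l \<mu> m"
  proof -
    have "P + P = smult 2 P" for P :: "complex poly" by (rule poly_eq_ext) simp
    then show ?thesis unfolding c cc by (simp add: smult_diff_right)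
  qed
  finally have "combination (\<lambda>i. cnj (?f $ i)) = q - placed_poly l \<mu> m" .
  from places_feedback[OF assms(1-3) this] have "places E A b l \<mu> m ?f" .
  moreover have "real_vec ?f" by (simp add: real_vec_def)
  ultimately show "\<exists>f. real_vec f \<and> places E A b l \<mu> m f" by blast
qed

end

theorem theorem7p1:
  fixes E A :: "complex^'n^'n" and b :: "complex^'n"
    and l :: nat and \<mu> :: "nat \<Rightarrow> ext_complex" and m :: "nat \<Rightarrow> nat"
  assumes "regular_pencil E A"
    and "inj_on \<mu> {1..l}"
    and "l \<le> M0 E A (- b)"
    and "\<And>i. i \<in> {1..l} \<Longrightarrow> m i \<noteq> 0"
    and "(\<Sum>i=1..l. m i) = M0 E A (- b)"
  shows
    "(\<not> invertible E \<and> (Infty \<in> \<mu> ` {1..l} \<longrightarrow> acts_at_infinity E A b) \<longrightarrow>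
        (\<exists>f. places E A b l \<mu> m f) \<and>
        (real_mat E \<and> real_mat A \<and> real_vec b \<and> conj_symmetric l \<mu> m \<longrightarrow>
           (\<exists>f. real_vec f \<and> places E A b l \<mu> m f))) \<and>
     (invertible E \<and> Infty \<notin> \<mu> ` {1..l} \<longrightarrow>
        (\<exists>f. places E A b l \<mu> m f) \<and>
        (real_mat E \<and> real_mat A \<and> real_vec b \<and> conj_symmetric l \<mu> m \<longrightarrow>
           (\<exists>f. real_vec f \<and> places E A b l \<mu> m f)))"
proof -
  obtain h q p where "reduced_pencil E A b h q p"
    using reduced_pencil_exists[OF assms(1)] by blast
  then interpret reduced_pencil E A b h q p .
  show ?thesis using placement[OF assms(2,4,5)] by blast
qed

end
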